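(* Let $\Omega\subset\mathbb{R}^N$ be a bounded domain, let $f$ satisfy (f1) and (f3), and let $u$ be the solution of $\inf\{\mathcal{I}_\Omega(v): v\in W^{1,\infty}_0(\Omega)\}$. Then $u\equiv0$ if and only if $f'(0)\,h(\Omega)\ge1$.
   Context: $\mathcal{I}_\Omega(v)=\int_\Omega [f(|Dv|)-v]\,dx$. The Cheeger constant of $\Omega$ is $h(\Omega)=\inf\Big\{\frac{\int_\Omega|D\phi|\,dx}{\int_\Omega|\phi|\,dx}:\ \phi\in C^1_0(\Omega),\ \phi\not\equiv0\Big\}$. (f1) $f\in C^1([0,\infty))$ is convex, monotone nondecreasing, $f(0)=0$ and $\lim_{s\to\infty}f(s)/s=+\infty$; (f3) $f'(0)>0$, $f\in C^{2,\alpha}(0,\infty)$ for some $0<\alpha<1$, and $f''(s)>0$ for every $s>0$. *)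

theory Defs
  imports "HOL-Analysis.Analysis"
begin

text \<open>Gradient of a real-valued function at a point (the vector g with
  Dv(x) h = g . h), chosen when v is differentiable at x.  For Lipschitz
  functions this is the a.e. gradient (Rademacher).\<close>
definition grad :: "('a::euclidean_space \<Rightarrow> real) \<Rightarrow> 'a \<Rightarrow> 'a" where
  "grad v x = (SOME g. (v has_derivative (\<lambda>h. g \<bullet> h)) (at x))"

definition domain :: "'a::euclidean_space set \<Rightarrow> bool" where
  "domain \<Omega> \<longleftrightarrow> open \<Omega> \<and> connected \<Omega> \<and> \<Omega> \<noteq> {}"

text \<open>W^{1,infinity}_0(Omega): Lipschitz functions vanishing outside Omega
  (functions on Omega extended by zero).\<close>
definition W1inf0 :: "'a::euclidean_space set \<Rightarrow> ('a \<Rightarrow> real) set" where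
  "W1inf0 \<Omega> = {v. (\<exists>C. C-lipschitz_on UNIV v) \<and> (\<forall>x. x \<notin> \<Omega> \<longrightarrow> v x = 0)}"

definition I_fun :: "(real \<Rightarrow> real) \<Rightarrow> 'a::euclidean_space set \<Rightarrow> ('a \<Rightarrow> real) \<Rightarrow> real" where
  "I_fun f \<Omega> v = (LINT x:\<Omega>|lebesgue. f (norm (grad v x)) - v x)"

definition C1_0 :: "'a::euclidean_space set \<Rightarrow> ('a \<Rightarrow> real) set" where
  "C1_0 \<Omega> = {\<phi>. (\<exists>g. continuous_on UNIV g \<and>
                     (\<forall>x. (\<phi> has_derivative (\<lambda>h. g x \<bullet> h)) (at x))) \<and>
                  compact (closure {x. \<phi> x \<noteq> 0}) \<and> closure {x. \<phi> x \<noteq> 0} \<subseteq> \<Omega>}"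

definition cheeger :: "'a::euclidean_space set \<Rightarrow> real" where
  "cheeger \<Omega> = Inf {(LINT x:\<Omega>|lebesgue. norm (grad \<phi> x)) / (LINT x:\<Omega>|lebesgue. \<bar>\<phi> x\<bar>)
                     | \<phi>. \<phi> \<in> C1_0 \<Omega> \<and> (\<exists>x. \<phi> x \<noteq> 0)}"

end

theory Submission
  imports Defs "HOL-Probability.Probability_Measure"
begin

text \<open>
  If \<open>u = 0\<close> is the minimizer, comparing it with \<open>t * \<bar>\<phi>\<bar>\<close> and letting \<open>t\<close> tend to \<open>0\<close> gives
  \<open>\<integral>\<bar>\<phi>\<bar> \<le> f'(0) \<integral>\<bar>D\<phi>\<bar>\<close> for every test function, i.e. \<open>h(\<Omega>) \<ge> 1 / f'(0)\<close>. Conversely, the Cheeger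
  inequality extends from \<open>C\<^sup>1\<close> test functions to Lipschitz functions vanishing outside \<open>\<Omega>\<close> (truncate,
  then average over small balls), so a minimizer \<open>u\<close> satisfies
  \<open>\<integral>\<bar>u\<bar> \<le> f'(0) \<integral>\<bar>Du\<bar> \<le> \<integral>f(\<bar>Du\<bar>) \<le> \<integral>u \<le> \<integral>\<bar>u\<bar>\<close>. Since \<open>f(s) > f'(0) s\<close> for \<open>s > 0\<close>, equality
  throughout forces \<open>Du = 0\<close> almost everywhere and hence \<open>u = 0\<close>.

  The gradient of a Lipschitz function is meaningful only through Rademacher's theorem. On the line,
  adding a multiple of the identity turns a Lipschitz function into an increasing one that is the
  indefinite integral of a Radon-Nikodym density, and Lebesgue's differentiation theorem applies.
  Directional derivatives then exist almost everywhere by Fubini's theorem, and their linearity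
  follows from an argument of Nekvinda and Zajicek.
\<close>

section \<open>Differentiability of Lipschitz functions on the line\<close>

lemma AE_lborel_not_in_negligible:
  "negligible N \<Longrightarrow> AE x in lborel. x \<notin> N"
  using AE_not_in[of N lebesgue] by (simp add: AE_completion_iff negligible_iff_null_sets)

lemma AE_lborel_uminus:
  assumes "AE x in lborel. P x"
  shows "AE x in lborel. P (- x :: real)"
proof -
  have "AE x in distr lborel borel uminus. P (x :: real)"
    unfolding lborel_distr_uminus by (rule assms)
  thus ?thesis by (rule AE_distrD[rotated]) simp
qed

lemma AE_tendsto_right_quotient_if_has_integral:
  fixes f F :: "real \<Rightarrow> real"
  assumes "\<And>a b. a \<le> b \<Longrightarrow> (f has_integral (F b - F a)) {a..b}"
  shows "AE x in lborel. ((\<lambda>h. (F (x + h) - F x) / h) \<longlongrightarrow> f x) (at_right 0)"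
proof -
  have "f integrable_on cbox a b" for a b
    using assms[of a b] by (cases "a \<le> b") auto
  then obtain N where "negligible N" and N: "\<And>x e. x \<notin> N \<Longrightarrow> 0 < e \<Longrightarrow>
      \<exists>d>0. \<forall>h. 0 < h \<and> h < d \<longrightarrow>
        norm (integral (cbox x (x + h *\<^sub>R One)) f /\<^sub>R h ^ DIM(real) - f x) < e"
    by (rule integrable_ccontinuous_explicit) (rule that)
  from AE_lborel_not_in_negligible[OF \<open>negligible N\<close>] show ?thesis
  proof eventually_elim
    case (elim x)
    show ?case
    proof (rule tendstoI)
      fix e :: real assume "e > 0"
      obtain d where "d > 0"
        and d: "\<And>h. 0 < h \<Longrightarrow> h < d \<Longrightarrow> \<bar>integral {x..x + h} f / h - f x\<bar> < e"
        using N[OF elim \<open>e > 0\<close>] by (auto simp: divide_inverse mult.commute)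
      have "dist ((F (x + h) - F x) / h) (f x) < e" if "h \<in> {0<..<d}" for h
        using d[of h] integral_unique[OF assms[of x "x + h"]] that by (simp add: dist_real_def)
      thus "\<forall>\<^sub>F h in at_right 0. dist ((F (x + h) - F x) / h) (f x) < e"
        using \<open>d > 0\<close> by (rule eventually_at_rightI)
    qed
  qed
qed

lemma AE_has_real_derivative_if_has_integral:
  fixes f F :: "real \<Rightarrow> real"
  assumes "\<And>a b. a \<le> b \<Longrightarrow> (f has_integral (F b - F a)) {a..b}"
  shows "AE x in lborel. (F has_real_derivative f x) (at x)"
proof -
  have right: "AE x in lborel. ((\<lambda>h. (F (x + h) - F x) / h) \<longlongrightarrow> f x) (at_right 0)"
    by (rule AE_tendsto_right_quotient_if_has_integral) (rule assms)
  have "AE x in lborel. ((\<lambda>h. (- F (- (x + h)) - (- F (- x))) / h) \<longlongrightarrow> f (- x)) (at_right 0)"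
  proof (rule AE_tendsto_right_quotient_if_has_integral)
    fix a b :: real assume "a \<le> b"
    thus "((\<lambda>x. f (- x)) has_integral (- F (- b)) - (- F (- a))) {a..b}"
      using has_integral_reflect_lemma_real[OF assms[of "- b" "- a"]] by simp
  qed
  from AE_lborel_uminus[OF this]
  have left: "AE x in lborel. ((\<lambda>h. (F x - F (x - h)) / h) \<longlongrightarrow> f x) (at_right 0)" by simp
  show ?thesis using left right
  proof eventually_elim
    case (elim x)
    have "(F (x + - h) - F x) / - h = (F x - F (x - h)) / h" for h
      using minus_divide_divide[of "F x - F (x - h)" h] by simp
    hence "((\<lambda>h. (F (x + h) - F x) / h) \<longlongrightarrow> f x) (at_left 0)"
      unfolding filterlim_at_left_to_right using elim(1) by simp
    thus ?case using elim(2) unfolding DERIV_def by (rule filterlim_split_at)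
  qed
qed

lemma lborel_null_sets_Lipschitz_image:
  fixes k :: "'a::euclidean_space \<Rightarrow> 'a"
  assumes "L-lipschitz_on UNIV k" "A \<in> null_sets lborel" "k ` A \<in> sets borel"
  shows "k ` A \<in> null_sets lborel"
proof -
  have "negligible A"
    using assms(2) null_sets_completion_iff[of A lborel] by (auto simp: negligible_iff_null_sets)
  hence "negligible (k ` A)"
  proof (rule negligible_locally_Lipschitz_image[OF order_refl])
    fix x assume "x \<in> A"
    show "\<exists>T B. open T \<and> x \<in> T \<and> (\<forall>y\<in>A \<inter> T. norm (k y - k x) \<le> B * norm (y - x))"
      using lipschitz_on_normD[OF assms(1)] by (intro exI[of _ UNIV] exI[of _ L]) simp
  qed
  thus ?thesis
    using assms(3) by (simp add: negligible_iff_null_sets null_sets_completion_iff)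
qed

lemma bij_if_expanding:
  fixes k :: "real \<Rightarrow> real"
  assumes "continuous_on UNIV k" and expanding: "\<And>a b. a \<le> b \<Longrightarrow> b - a \<le> k b - k a"
  shows "bij k"
proof (rule bijI)
  show "inj k"
  proof (rule linorder_injI)
    fix a b :: real assume "a < b"
    thus "k a \<noteq> k b" using expanding[of a b] by simp
  qed
  show "surj k"
    unfolding surj_def
  proof
    fix y
    define r where "r = \<bar>y - k 0\<bar>"
    have "k (- r) \<le> y" "y \<le> k r"
      using expanding[of "- r" 0] expanding[of 0 r] by (auto simp: r_def)
    moreover have "- r \<le> r" by (simp add: r_def)
    moreover have "continuous_on {- r..r} k" by (rule continuous_on_subset[OF assms(1)]) simp
    ultimately have "\<exists>x. - r \<le> x \<and> x \<le> r \<and> k x = y" by (rule IVT')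
    thus "\<exists>x. y = k x" by blast
  qed
qed

lemma has_integral_if_density_lborel:
  fixes D :: "'a::euclidean_space \<Rightarrow> ennreal"
  assumes [measurable]: "D \<in> borel_measurable borel" "A \<in> sets borel"
    and "emeasure (density lborel D) A = ennreal c" "c \<ge> 0"
  shows "((\<lambda>x. enn2real (D x)) has_integral c) A"
proof -
  have D: "(\<integral>\<^sup>+x. D x * indicator A x \<partial>lborel) = ennreal c"
    using assms(3) by (simp add: emeasure_density)
  hence "AE x in lborel. D x * indicator A x \<noteq> \<infinity>"
    by (intro nn_integral_noteq_infinite) auto
  hence "AE x in lborel. ennreal (enn2real (D x) * indicator A x) = D x * indicator A x"
    by eventually_elim (auto simp: indicator_def ennreal_enn2real_if)
  hence "(\<integral>\<^sup>+x. ennreal (enn2real (D x) * indicator A x) \<partial>lborel) =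
      (\<integral>\<^sup>+x. D x * indicator A x \<partial>lborel)"
    by (rule nn_integral_cong_AE)
  hence "((\<lambda>x. enn2real (D x) * indicator A x) has_integral c) UNIV"
    using D assms(4) by (intro nn_integral_has_integral) auto
  moreover have "(\<lambda>x. enn2real (D x) * indicator A x) = (\<lambda>x. if x \<in> A then enn2real (D x) else 0)"
    by (auto simp: indicator_def)
  ultimately show ?thesis by (simp add: has_integral_restrict_UNIV)
qed

text \<open>The density is the Radon--Nikodym derivative of \<open>A \<mapsto> \<bar>k ` A\<bar>\<close>.\<close>
lemma expanding_Lipschitz_has_density:
  fixes k :: "real \<Rightarrow> real"
  assumes lip: "L-lipschitz_on UNIV k" and expanding: "\<And>a b. a \<le> b \<Longrightarrow> b - a \<le> k b - k a"
  obtains f where "\<And>a b. a \<le> b \<Longrightarrow> (f has_integral (k b - k a)) {a..b}"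
proof -
  have bij: "bij k"
    using lipschitz_on_continuous_on[OF lip] expanding by (rule bij_if_expanding)
  hence vimage: "inv k -` A = k ` A" for A
    by (metis bij_imp_bij_inv bij_vimage_eq_inv_image inv_inv_eq)
  have le_iff: "k a \<le> k b \<longleftrightarrow> a \<le> b" for a b
    using expanding[of a b] expanding[of b a] by linarith
  have k_inv: "k (inv k y) = y" for y
    using bij by (simp add: bij_is_surj surj_f_inv_f)
  have "mono (inv k)"
    using le_iff[of "inv k _" "inv k _"] by (intro monoI) (simp add: k_inv)
  hence [measurable]: "inv k \<in> borel_measurable borel" by (rule borel_measurable_mono)
  hence image_borel: "k ` A \<in> sets borel" if "A \<in> sets borel" for A
    using measurable_sets[OF _ that, of "inv k" borel] by (simp add: vimage)
  define M where "M = distr lborel borel (inv k)"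
  have M: "emeasure M A = emeasure lborel (k ` A)" if "A \<in> sets borel" for A
    using that by (simp add: M_def emeasure_distr vimage)
  have "absolutely_continuous lborel M"
    unfolding absolutely_continuous_def
  proof
    fix A :: "real set" assume A: "A \<in> null_sets lborel"
    hence "k ` A \<in> null_sets lborel"
      by (intro lborel_null_sets_Lipschitz_image[OF lip] image_borel) auto
    thus "A \<in> null_sets M" using A M[of A] by (auto simp: null_sets_def M_def)
  qed
  then obtain D where D [measurable]: "D \<in> borel_measurable borel" and MD: "density lborel D = M"
    using sigma_finite_measure.Radon_Nikodym[OF sigma_finite_lborel, of M] by (auto simp: M_def)
  have "((\<lambda>x. enn2real (D x)) has_integral (k b - k a)) {a..b}" if "a \<le> b" for a b
  proof (rule has_integral_if_density_lborel)
    have "k ` {a..b} = {k a..k b}"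
      using le_iff[of a "inv k _"] le_iff[of "inv k _" b] by (auto simp: k_inv simp flip: vimage)
    thus "emeasure (density lborel D) {a..b} = ennreal (k b - k a)"
      using that le_iff by (simp add: MD M)
  qed (use that le_iff in auto)
  thus ?thesis by (rule that)
qed

theorem AE_differentiable_if_lipschitz_real:
  fixes g :: "real \<Rightarrow> real"
  assumes lip: "L-lipschitz_on UNIV g"
  shows "AE x in lborel. g differentiable (at x)"
proof -
  define k where "k = (\<lambda>x. g x + (L + 1) * x)"
  have k_lip: "(L + \<bar>L + 1\<bar> * 1)-lipschitz_on UNIV k"
    unfolding k_def by (intro lipschitz_on_add lipschitz_on_cmult_real lipschitz_on_id lip)
  have k_expanding: "b - a \<le> k b - k a" if "a \<le> b" for a b
    using lipschitz_onD[OF lip, of a b] that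
    by (simp add: k_def dist_real_def algebra_simps abs_le_iff)
  obtain f where "\<And>a b. a \<le> b \<Longrightarrow> (f has_integral (k b - k a)) {a..b}"
    using expanding_Lipschitz_has_density[OF k_lip] k_expanding by blast
  hence "AE x in lborel. (k has_real_derivative f x) (at x)"
    by (rule AE_has_real_derivative_if_has_integral)
  thus ?thesis
  proof eventually_elim
    case (elim x)
    hence "((\<lambda>x. k x - (L + 1) * x) has_real_derivative f x - (L + 1)) (at x)"
      by (auto intro!: derivative_eq_intros)
    thus ?case by (auto simp: k_def real_differentiable_def)
  qed
qed

section \<open>Rademacher's theorem\<close>

lemma AE_lborel_translate:
  fixes c :: "'a::euclidean_space"
  assumes "AE x in lborel. P x"
  shows "AE x in lborel. P (c + x)"
proof -
  have "AE x in distr lborel borel ((+) c). P x"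
    unfolding lborel_distr_plus by (rule assms)
  thus ?thesis by (rule AE_distrD[rotated]) simp
qed

lemma nn_integral_lborel_translate:
  fixes f :: "'a::euclidean_space \<Rightarrow> ennreal"
  assumes "f \<in> borel_measurable borel"
  shows "(\<integral>\<^sup>+x. f (x + c) \<partial>lborel) = (\<integral>\<^sup>+x. f x \<partial>lborel)"
proof -
  have "(\<integral>\<^sup>+x. f x \<partial>lborel) = (\<integral>\<^sup>+x. f x \<partial>distr lborel borel ((+) c))"
    by (simp add: lborel_distr_plus)
  also have "\<dots> = (\<integral>\<^sup>+x. f (x + c) \<partial>lborel)"
    using assms by (subst nn_integral_distr) (auto simp: add.commute)
  finally show ?thesis by simp
qed

lemma null_set_if_null_on_lines:
  fixes A :: "'a::euclidean_space set" and v :: 'a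
  assumes A [measurable]: "A \<in> sets borel"
    and lines: "\<And>x. AE t in lborel. x + t *\<^sub>R v \<notin> A"
  shows "A \<in> null_sets lborel"
proof -
  define F :: "'a \<Rightarrow> real \<Rightarrow> ennreal"
    where "F = (\<lambda>x t. indicator {0..1} t * indicator A (x + t *\<^sub>R v))"
  have [measurable]: "case_prod F \<in> borel_measurable (lborel \<Otimes>\<^sub>M lborel)"
    unfolding F_def by measurable
  have "(\<integral>\<^sup>+t. F x t \<partial>lborel) = 0" for x
  proof -
    have "AE t in lborel. F x t = 0"
      using lines[of x] by eventually_elim (simp add: F_def)
    thus ?thesis by (subst nn_integral_cong_AE) auto
  qed
  hence "0 = (\<integral>\<^sup>+x. (\<integral>\<^sup>+t. F x t \<partial>lborel) \<partial>lborel)" by simp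
  also have "\<dots> = (\<integral>\<^sup>+t. (\<integral>\<^sup>+x. F x t \<partial>lborel) \<partial>lborel)"
    by (rule lborel_pair.Fubini'[symmetric]) measurable
  also have "\<dots> = (\<integral>\<^sup>+t. indicator {0..1::real} t * emeasure lborel A \<partial>lborel)"
  proof (rule nn_integral_cong)
    fix t :: real
    have "(\<integral>\<^sup>+x. indicator A (x + t *\<^sub>R v) \<partial>lborel) = emeasure lborel A"
      by (subst nn_integral_lborel_translate) auto
    thus "(\<integral>\<^sup>+x. F x t \<partial>lborel) = indicator {0..1} t * emeasure lborel A"
      unfolding F_def by (subst nn_integral_cmult) auto
  qed
  also have "\<dots> = emeasure lborel A" by (simp add: nn_integral_multc)
  finally show ?thesis by auto
qed

text \<open>For \<open>t = 0\<close> the quotient is the junk value \<open>0\<close>.\<close>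
definition difference_quotient :: "('a::real_vector \<Rightarrow> real) \<Rightarrow> 'a \<Rightarrow> 'a \<Rightarrow> real \<Rightarrow> real" where
  "difference_quotient u x v t = (u (x + t *\<^sub>R v) - u x) / t"

abbreviation has_dir_deriv :: "('a::real_vector \<Rightarrow> real) \<Rightarrow> 'a \<Rightarrow> 'a \<Rightarrow> real \<Rightarrow> bool" where
  "has_dir_deriv u x v l \<equiv> (difference_quotient u x v \<longlongrightarrow> l) (at 0)"

lemma difference_quotient_add:
  "difference_quotient u x (v + w) t =
     difference_quotient u x v t + difference_quotient u (x + t *\<^sub>R v) w t"
  by (simp add: difference_quotient_def scaleR_add_right add.assoc flip: add_divide_distrib)

lemma lipschitz_difference_quotient:
  fixes u :: "'a::real_normed_vector \<Rightarrow> real"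
  assumes lip: "L-lipschitz_on UNIV u"
  shows "L-lipschitz_on UNIV (\<lambda>v. difference_quotient u x v t)"
proof (rule lipschitz_onI)
  fix v w :: 'a
  have "\<bar>u (x + t *\<^sub>R v) - u (x + t *\<^sub>R w)\<bar> \<le> L * (norm (v - w) * \<bar>t\<bar>)"
    using lipschitz_onD[OF lip, of "x + t *\<^sub>R v" "x + t *\<^sub>R w"]
    by (simp add: dist_norm mult.commute flip: scaleR_diff_right)
  moreover have "difference_quotient u x v t - difference_quotient u x w t =
      (u (x + t *\<^sub>R v) - u (x + t *\<^sub>R w)) / t"
    by (simp add: difference_quotient_def flip: diff_divide_distrib)
  ultimately show "dist (difference_quotient u x v t) (difference_quotient u x w t) \<le> L * dist v w"
    using lipschitz_on_nonneg[OF lip]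
    by (cases "t = 0") (simp_all add: dist_norm abs_divide pos_divide_le_eq mult.assoc)
qed (rule lipschitz_on_nonneg[OF lip])

lemma has_dir_deriv_scaleR:
  assumes "has_dir_deriv u x v l"
  shows "has_dir_deriv u x (c *\<^sub>R v) (c * l)"
proof (cases "c = 0")
  case True
  thus ?thesis by (simp add: difference_quotient_def[abs_def])
next
  case False
  hence "filterlim (\<lambda>t. c * t) (at 0) (at 0)"
    by (auto intro!: filterlim_atI tendsto_eq_intros simp: eventually_at_filter)
  hence "((\<lambda>t. c * difference_quotient u x v (c * t)) \<longlongrightarrow> c * l) (at 0)"
    by (intro tendsto_mult_left filterlim_compose[OF assms])
  moreover have "difference_quotient u x (c *\<^sub>R v) = (\<lambda>t. c * difference_quotient u x v (c * t))"
    using False by (auto simp: difference_quotient_def mult.commute)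
  ultimately show ?thesis by simp
qed

definition approx_dir_deriv :: "('a::real_vector \<Rightarrow> real) \<Rightarrow> 'a \<Rightarrow> real \<Rightarrow> real \<Rightarrow> real \<Rightarrow> 'a set" where
  "approx_dir_deriv u v y e d =
     {x. \<forall>t. t \<noteq> 0 \<and> \<bar>t\<bar> < d \<longrightarrow> \<bar>difference_quotient u x v t - y\<bar> \<le> e}"

lemma approx_dir_derivD:
  "x \<in> approx_dir_deriv u v y e d \<Longrightarrow> t \<noteq> 0 \<Longrightarrow> \<bar>t\<bar> < d \<Longrightarrow> \<bar>difference_quotient u x v t - y\<bar> \<le> e"
  by (simp add: approx_dir_deriv_def)

lemma closed_approx_dir_deriv:
  fixes u :: "'a::real_normed_vector \<Rightarrow> real"
  assumes "continuous_on UNIV u"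
  shows "closed (approx_dir_deriv u v y e d)"
proof -
  have "approx_dir_deriv u v y e d =
          (\<Inter>t\<in>{t. t \<noteq> 0 \<and> \<bar>t\<bar> < d}. {x. \<bar>difference_quotient u x v t - y\<bar> \<le> e})"
    by (auto simp: approx_dir_deriv_def)
  moreover have "closed {x. \<bar>difference_quotient u x v t - y\<bar> \<le> e}" if "t \<noteq> 0" for t
    unfolding difference_quotient_def
    using that by (intro closed_Collect_le continuous_intros continuous_on_compose2[OF assms]) auto
  ultimately show ?thesis by auto
qed

lemma eventually_in_approx_dir_deriv:
  assumes "has_dir_deriv u x v l" "\<bar>l - y\<bar> < e"
  shows "\<forall>\<^sub>F n in sequentially. x \<in> approx_dir_deriv u v y e (1 / real (Suc n))"
proof -
  have "((\<lambda>t. \<bar>difference_quotient u x v t - y\<bar>) \<longlongrightarrow> \<bar>l - y\<bar>) (at 0)"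
    by (intro tendsto_intros assms(1))
  hence "\<forall>\<^sub>F t in at 0. \<bar>difference_quotient u x v t - y\<bar> < e"
    using assms(2) by (rule order_tendstoD)
  then obtain d where "d > 0"
    and d: "\<And>t. t \<noteq> 0 \<Longrightarrow> \<bar>t\<bar> < d \<Longrightarrow> \<bar>difference_quotient u x v t - y\<bar> < e"
    by (auto simp: eventually_at)
  have "\<forall>\<^sub>F n in sequentially. 1 / real (Suc n) < d"
    by (rule order_tendstoD(2)[OF LIMSEQ_Suc[OF lim_const_over_n] \<open>d > 0\<close>])
  thus ?thesis
    by eventually_elim (use d in \<open>force simp: approx_dir_deriv_def\<close>)
qed

lemma ex_rat_near: "e > 0 \<Longrightarrow> \<exists>y\<in>\<rat>. \<bar>l - y\<bar> < (e :: real)"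
  using Rats_dense_in_real[of l "l + e"] by force

lemma ex_dir_deriv_iff:
  "(\<exists>l. has_dir_deriv u x v l) \<longleftrightarrow>
     (\<forall>m. \<exists>y\<in>\<rat>. \<exists>n. x \<in> approx_dir_deriv u v y (1 / real (Suc m)) (1 / real (Suc n)))"
proof safe
  fix l m assume l: "has_dir_deriv u x v l"
  obtain y where y: "y \<in> \<rat>" "\<bar>l - y\<bar> < 1 / real (Suc m)"
    using ex_rat_near[of "1 / real (Suc m)" l] by auto
  thus "\<exists>y\<in>\<rat>. \<exists>n. x \<in> approx_dir_deriv u v y (1 / real (Suc m)) (1 / real (Suc n))"
    using eventually_happens'[OF _ eventually_in_approx_dir_deriv[OF l y(2)]] by auto
next
  assume approx: "\<forall>m. \<exists>y\<in>\<rat>. \<exists>n. x \<in> approx_dir_deriv u v y (1 / real (Suc m)) (1 / real (Suc n))"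
  have "cauchy_filter (filtermap (difference_quotient u x v) (at 0))"
    unfolding cauchy_filter_metric_filtermap
  proof (intro allI impI)
    fix e :: real assume "e > 0"
    then obtain m where m: "1 / real (Suc m) < e / 2"
      by (metis half_gt_zero nat_approx_posE)
    obtain y n where yn: "x \<in> approx_dir_deriv u v y (1 / real (Suc m)) (1 / real (Suc n))"
      using approx by blast
    show "\<exists>P. eventually P (at 0) \<and>
        (\<forall>s t. P s \<and> P t \<longrightarrow> dist (difference_quotient u x v s) (difference_quotient u x v t) < e)"
    proof (intro exI conjI allI impI)
      show "\<forall>\<^sub>F t in at 0. t \<noteq> 0 \<and> \<bar>t\<bar> < 1 / real (Suc n)"
        unfolding eventually_at by (intro exI[of _ "1 / real (Suc n)"]) auto
    next
      fix s t assume "(s \<noteq> 0 \<and> \<bar>s\<bar> < 1 / real (Suc n)) \<and> (t \<noteq> 0 \<and> \<bar>t\<bar> < 1 / real (Suc n))"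
      thus "dist (difference_quotient u x v s) (difference_quotient u x v t) < e"
        using approx_dir_derivD[OF yn, of s] approx_dir_derivD[OF yn, of t] m
        unfolding dist_real_def by linarith
    qed
  qed
  hence "convergent_filter (filtermap (difference_quotient u x v) (at 0))"
    by (rule cauchy_filter_convergent)
  thus "\<exists>l. has_dir_deriv u x v l"
    by (simp add: convergent_filter_iff filterlim_def)
qed

lemma borel_ex_dir_deriv:
  fixes u :: "'a::euclidean_space \<Rightarrow> real"
  assumes "continuous_on UNIV u"
  shows "{x. \<exists>l. has_dir_deriv u x v l} \<in> sets borel"
proof -
  have "{x. \<exists>l. has_dir_deriv u x v l} =
      (\<Inter>m. \<Union>y\<in>\<rat>. \<Union>n. approx_dir_deriv u v y (1 / real (Suc m)) (1 / real (Suc n)))"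
    by (auto simp: ex_dir_deriv_iff)
  also have "\<dots> \<in> sets borel"
    by (intro sets.countable_INT'' sets.countable_UN'' countable_rat countableI_type
        borel_closed[OF closed_approx_dir_deriv[OF assms]]) simp
  finally show ?thesis .
qed

lemma AE_ex_dir_deriv:
  fixes u :: "'a::euclidean_space \<Rightarrow> real"
  assumes lip: "L-lipschitz_on UNIV u"
  shows "AE x in lborel. \<exists>l. has_dir_deriv u x v l"
proof -
  define A where "A = - {x. \<exists>l. has_dir_deriv u x v l}"
  have "A \<in> null_sets lborel"
  proof (rule null_set_if_null_on_lines[where v = v])
    show "A \<in> sets borel"
      unfolding A_def using borel_ex_dir_deriv[OF lipschitz_on_continuous_on[OF lip]] by simp
    fix x
    have "(L * norm v)-lipschitz_on UNIV (\<lambda>t. u (x + t *\<^sub>R v))"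
    proof (rule lipschitz_onI)
      fix s t :: real
      show "dist (u (x + s *\<^sub>R v)) (u (x + t *\<^sub>R v)) \<le> L * norm v * dist s t"
        using lipschitz_onD[OF lip, of "x + s *\<^sub>R v" "x + t *\<^sub>R v"]
        by (simp add: dist_norm mult_ac flip: scaleR_left_diff_distrib)
    qed (use lipschitz_on_nonneg[OF lip] in auto)
    hence "AE t in lborel. (\<lambda>t. u (x + t *\<^sub>R v)) differentiable (at t)"
      by (rule AE_differentiable_if_lipschitz_real)
    thus "AE t in lborel. x + t *\<^sub>R v \<notin> A"
    proof eventually_elim
      case (elim t)
      then obtain l where "((\<lambda>t. u (x + t *\<^sub>R v)) has_real_derivative l) (at t)"
        by (auto simp: real_differentiable_def)
      hence "has_dir_deriv u (x + t *\<^sub>R v) v l"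
        by (simp add: DERIV_def difference_quotient_def[abs_def] algebra_simps)
      thus ?case by (auto simp: A_def)
    qed
  qed
  thus ?thesis by (auto simp: A_def dest: AE_not_in)
qed

lemma uniform_discrete_imp_countable:
  fixes S :: "'a::{heine_borel, real_normed_vector} set"
  assumes "uniform_discrete S"
  shows "countable S"
proof -
  have "finite (S \<inter> cball 0 (real n))" for n
    using assms by (auto simp: bounded_Int simp flip: uniform_discrete_finite_iff)
  hence "countable (\<Union>n. S \<inter> cball 0 (real n))"
    by (intro countable_UN countableI_type countable_finite)
  moreover have "S \<subseteq> (\<Union>n. S \<inter> cball 0 (real n))" using real_arch_simple by auto
  ultimately show ?thesis by (rule countable_subset[rotated])
qed

definition approx_dir_deriv_triple ::
    "('a::real_vector \<Rightarrow> real) \<Rightarrow> 'a \<Rightarrow> 'a \<Rightarrow> real \<Rightarrow> real \<Rightarrow> real \<Rightarrow> real \<Rightarrow> real \<Rightarrow> 'a set" where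
  "approx_dir_deriv_triple u v w y z y' e d =
     approx_dir_deriv u v y e d \<inter> approx_dir_deriv u w z e d \<inter> approx_dir_deriv u (v + w) y' e d"

text \<open>The step due to Nekvinda and Zajicek: by \<open>difference_quotient_add\<close>, two points of the triple
  intersection on a common line in direction \<open>v\<close> cannot be close to each other.\<close>
lemma null_set_approx_dir_deriv_triple:
  fixes u :: "'a::euclidean_space \<Rightarrow> real"
  assumes cont: "continuous_on UNIV u" and gap: "\<bar>y' - y - z\<bar> > 3 * e" and "d > 0"
  shows "approx_dir_deriv_triple u v w y z y' e d \<in> null_sets lborel" (is "?E \<in> _")
proof (rule null_set_if_null_on_lines[where v = v])
  show "?E \<in> sets borel"
    unfolding approx_dir_deriv_triple_def
    by (intro sets.Int borel_closed closed_approx_dir_deriv cont)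
  fix x
  have "uniform_discrete {t. x + t *\<^sub>R v \<in> ?E}"
    unfolding uniform_discrete_def
  proof (intro exI[of _ d] conjI ballI impI \<open>d > 0\<close>, rule ccontr)
    fix s t assume st: "s \<in> {t. x + t *\<^sub>R v \<in> ?E}" "t \<in> {t. x + t *\<^sub>R v \<in> ?E}"
      and near: "dist s t < d" "s \<noteq> t"
    define a r where "a = x + s *\<^sub>R v" and "r = t - s"
    have r: "r \<noteq> 0" "\<bar>r\<bar> < d" using near by (auto simp: r_def dist_real_def)
    have "a + r *\<^sub>R v = x + t *\<^sub>R v" by (simp add: a_def r_def algebra_simps)
    hence "\<bar>difference_quotient u (a + r *\<^sub>R v) w r - z\<bar> \<le> e"
      using st(2) r by (auto simp: approx_dir_deriv_triple_def intro: approx_dir_derivD)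
    moreover have "\<bar>difference_quotient u a v r - y\<bar> \<le> e"
      "\<bar>difference_quotient u a (v + w) r - y'\<bar> \<le> e"
      using st(1) r by (auto simp: a_def approx_dir_deriv_triple_def intro: approx_dir_derivD)
    ultimately show False using gap unfolding difference_quotient_add by linarith
  qed
  hence "{t. x + t *\<^sub>R v \<in> ?E} \<in> null_sets lborel"
    by (intro countable_imp_null_set_lborel uniform_discrete_imp_countable)
  thus "AE t in lborel. x + t *\<^sub>R v \<notin> ?E" by (auto dest: AE_not_in)
qed

lemma ex_approx_dir_deriv_triple_if_nonadditive:
  assumes l: "has_dir_deriv u x v l1" "has_dir_deriv u x w l2" "has_dir_deriv u x (v + w) l3"
    and "l3 \<noteq> l1 + l2"
  obtains y z y' e n where "y \<in> \<rat>" "z \<in> \<rat>" "y' \<in> \<rat>" "e \<in> \<rat>" "\<bar>y' - y - z\<bar> > 3 * e"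
    "x \<in> approx_dir_deriv_triple u v w y z y' e (1 / real (Suc n))"
proof -
  have "0 < \<bar>l3 - l1 - l2\<bar> / 6" using \<open>l3 \<noteq> l1 + l2\<close> by simp
  then obtain e where e: "e \<in> \<rat>" "0 < e" "e < \<bar>l3 - l1 - l2\<bar> / 6"
    using Rats_dense_in_real by blast
  obtain y where y: "y \<in> \<rat>" "\<bar>l1 - y\<bar> < e" using ex_rat_near[OF e(2)] by blast
  obtain z where z: "z \<in> \<rat>" "\<bar>l2 - z\<bar> < e" using ex_rat_near[OF e(2)] by blast
  obtain y' where y': "y' \<in> \<rat>" "\<bar>l3 - y'\<bar> < e" using ex_rat_near[OF e(2)] by blast
  have "\<forall>\<^sub>F n in sequentially. x \<in> approx_dir_deriv_triple u v w y z y' e (1 / real (Suc n))"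
    using eventually_in_approx_dir_deriv[OF l(1) y(2)] eventually_in_approx_dir_deriv[OF l(2) z(2)]
      eventually_in_approx_dir_deriv[OF l(3) y'(2)]
    by eventually_elim (simp add: approx_dir_deriv_triple_def)
  then obtain n where "x \<in> approx_dir_deriv_triple u v w y z y' e (1 / real (Suc n))"
    using eventually_happens' sequentially_bot by blast
  moreover have "\<bar>l3 - l1 - l2\<bar> \<le> \<bar>y' - y - z\<bar> + \<bar>l3 - y'\<bar> + \<bar>l1 - y\<bar> + \<bar>l2 - z\<bar>" by linarith
  hence "\<bar>y' - y - z\<bar> > 3 * e" using e(3) y(2) z(2) y'(2) by linarith
  ultimately show ?thesis using y(1) z(1) y'(1) e(1) that by blast
qed

lemma AE_dir_deriv_add:
  fixes u :: "'a::euclidean_space \<Rightarrow> real"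
  assumes cont: "continuous_on UNIV u"
  shows "AE x in lborel. \<forall>l1 l2 l3. has_dir_deriv u x v l1 \<longrightarrow> has_dir_deriv u x w l2 \<longrightarrow>
           has_dir_deriv u x (v + w) l3 \<longrightarrow> l3 = l1 + l2"
proof -
  have "AE x in lborel. \<bar>y' - y - z\<bar> > 3 * e \<longrightarrow>
      x \<notin> approx_dir_deriv_triple u v w y z y' e (1 / real (Suc n))" for y z y' e n
    using null_set_approx_dir_deriv_triple[OF cont, of e y' y z "1 / real (Suc n)" v w, THEN AE_not_in]
    by (cases "\<bar>y' - y - z\<bar> > 3 * e") auto
  hence "AE x in lborel. \<forall>y\<in>\<rat>. \<forall>z\<in>\<rat>. \<forall>y'\<in>\<rat>. \<forall>e\<in>\<rat>. \<forall>n. \<bar>y' - y - z\<bar> > 3 * e \<longrightarrow>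
      x \<notin> approx_dir_deriv_triple u v w y z y' e (1 / real (Suc n))"
    by (simp only: AE_ball_countable countable_rat AE_all_countable) blast
  thus ?thesis
  proof eventually_elim
    case (elim x)
    show ?case
    proof (intro allI impI, rule ccontr)
      fix l1 l2 l3
      assume "has_dir_deriv u x v l1" "has_dir_deriv u x w l2" "has_dir_deriv u x (v + w) l3"
        "l3 \<noteq> l1 + l2"
      thus False by (rule ex_approx_dir_deriv_triple_if_nonadditive) (use elim in blast)
    qed
  qed
qed

lemma AE_dir_deriv_sum:
  fixes u :: "'a::euclidean_space \<Rightarrow> real"
  assumes lip: "L-lipschitz_on UNIV u" and "finite B"
  shows "AE x in lborel. \<forall>D. (\<forall>b\<in>B. has_dir_deriv u x b (D b)) \<longrightarrow>
           has_dir_deriv u x (\<Sum>b\<in>B. c b *\<^sub>R b) (\<Sum>b\<in>B. c b * D b)"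
  using \<open>finite B\<close>
proof induction
  case empty
  show ?case by (simp add: difference_quotient_def[abs_def])
next
  case (insert b B)
  let ?v = "c b *\<^sub>R b" and ?w = "\<Sum>b\<in>B. c b *\<^sub>R b"
  show ?case
    using insert.IH AE_dir_deriv_add[OF lipschitz_on_continuous_on[OF lip], of ?v ?w]
      AE_ex_dir_deriv[OF lip, of "?v + ?w"]
  proof eventually_elim
    case (elim x)
    show ?case
    proof (intro allI impI)
      fix D assume D: "\<forall>b\<in>insert b B. has_dir_deriv u x b (D b)"
      obtain l where l: "has_dir_deriv u x (?v + ?w) l" using elim(3) by blast
      have "has_dir_deriv u x ?w (\<Sum>b\<in>B. c b * D b)" "has_dir_deriv u x ?v (c b * D b)"
        using elim(1) D by (auto intro: has_dir_deriv_scaleR)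
      hence "l = c b * D b + (\<Sum>b\<in>B. c b * D b)" using elim(2) l by blast
      thus "has_dir_deriv u x (\<Sum>b\<in>insert b B. c b *\<^sub>R b) (\<Sum>b\<in>insert b B. c b * D b)"
        using l insert.hyps by simp
    qed
  qed
qed

lemma difference_quotient_tendsto_uniformly:
  fixes u :: "'a::euclidean_space \<Rightarrow> real"
  assumes lip: "L-lipschitz_on UNIV u"
    and dense: "\<And>X. open X \<Longrightarrow> X \<noteq> {} \<Longrightarrow> \<exists>d\<in>S. d \<in> X"
    and dir: "\<And>v. v \<in> S \<Longrightarrow> has_dir_deriv u x v (g \<bullet> v)"
    and "compact K" "e > 0"
  shows "\<forall>\<^sub>F t in at 0. \<forall>z\<in>K. \<bar>difference_quotient u x z t - g \<bullet> z\<bar> < e"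
proof -
  define r where "r = e / (1 + L + norm g)"
  have L: "L \<ge> 0" using lip by (rule lipschitz_on_nonneg)
  have "1 + L + norm g > 0" using L by (simp add: add_pos_nonneg)
  hence "r > 0" "r * (1 + L + norm g) = e"
    using \<open>e > 0\<close> by (simp_all add: r_def)
  hence r: "r > 0" "r + L * r + norm g * r = e" by (simp_all add: algebra_simps)
  have "K \<subseteq> (\<Union>v\<in>S. ball v r)"
  proof
    fix z assume "z \<in> K"
    obtain v where "v \<in> S" "v \<in> ball z r" using dense[of "ball z r"] r(1) by auto
    thus "z \<in> (\<Union>v\<in>S. ball v r)" by (auto simp: dist_commute)
  qed
  then obtain V where V: "V \<subseteq> S" "finite V" "K \<subseteq> (\<Union>v\<in>V. ball v r)"
    using compactE_image[OF \<open>compact K\<close>, of S "\<lambda>v. ball v r"] by (metis open_ball)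
  have "\<forall>\<^sub>F t in at 0. \<bar>difference_quotient u x v t - g \<bullet> v\<bar> < r" if "v \<in> V" for v
    using tendstoD[OF dir r(1)] that V(1) by (auto simp: dist_real_def)
  hence "\<forall>\<^sub>F t in at 0. \<forall>v\<in>V. \<bar>difference_quotient u x v t - g \<bullet> v\<bar> < r"
    using V(2) by (intro eventually_ball_finite) auto
  thus ?thesis
  proof eventually_elim
    case (elim t)
    show ?case
    proof
      fix z assume "z \<in> K"
      then obtain v where v: "v \<in> V" "dist z v < r" using V(3) by (force simp: dist_commute)
      have "\<bar>difference_quotient u x z t - difference_quotient u x v t\<bar> \<le> L * r"
        using lipschitz_onD[OF lipschitz_difference_quotient[OF lip], of z v x t]
          mult_left_mono[of "dist z v" r L] v(2) L by (simp add: dist_real_def)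
      moreover have "\<bar>g \<bullet> v - g \<bullet> z\<bar> \<le> norm g * r"
        using Cauchy_Schwarz_ineq2[of g "v - z"] mult_left_mono[of "dist z v" r "norm g"] v(2)
        by (simp add: inner_diff_right dist_norm norm_minus_commute)
      ultimately show "\<bar>difference_quotient u x z t - g \<bullet> z\<bar> < e"
        using bspec[OF elim v(1)] r(2) by linarith
    qed
  qed
qed

lemma has_derivative_if_dense_dir_derivs:
  fixes u :: "'a::euclidean_space \<Rightarrow> real"
  assumes lip: "L-lipschitz_on UNIV u"
    and dense: "\<And>X. open X \<Longrightarrow> X \<noteq> {} \<Longrightarrow> \<exists>d\<in>S. d \<in> X"
    and dir: "\<And>v. v \<in> S \<Longrightarrow> has_dir_deriv u x v (g \<bullet> v)"
  shows "(u has_derivative (\<lambda>h. g \<bullet> h)) (at x)"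
  unfolding has_derivative_at_alt
proof (intro conjI allI impI bounded_linear_inner_right)
  fix e :: real assume "e > 0"
  have "\<forall>\<^sub>F t in at 0. \<forall>z\<in>sphere 0 1. \<bar>difference_quotient u x z t - g \<bullet> z\<bar> < e"
    by (rule difference_quotient_tendsto_uniformly[OF lip dense dir compact_sphere \<open>e > 0\<close>])
  then obtain d where "d > 0"
    and d: "\<And>t z. t \<noteq> 0 \<Longrightarrow> \<bar>t\<bar> < d \<Longrightarrow> norm z = 1 \<Longrightarrow> \<bar>difference_quotient u x z t - g \<bullet> z\<bar> < e"
    by (auto simp: eventually_at)
  have "norm (u y - u x - g \<bullet> (y - x)) \<le> e * norm (y - x)" if y: "norm (y - x) < d" for y
  proof (cases "y = x")
    case False
    define t z where "t = norm (y - x)" and "z = (1 / t) *\<^sub>R (y - x)"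
    have t: "t > 0" "t < d" using False y by (auto simp: t_def)
    have z: "norm z = 1" "y = x + t *\<^sub>R z" using t by (auto simp: z_def t_def)
    have "u y - u x - g \<bullet> (y - x) = t * (difference_quotient u x z t - g \<bullet> z)"
      using t by (simp add: z(2) difference_quotient_def right_diff_distrib diff_divide_distrib)
    hence "norm (u y - u x - g \<bullet> (y - x)) = t * \<bar>difference_quotient u x z t - g \<bullet> z\<bar>"
      using t by (simp add: abs_mult)
    also have "\<dots> \<le> t * e" using d[of t z] t z by (intro mult_left_mono) auto
    finally show ?thesis by (simp add: t_def mult.commute)
  qed simp
  thus "\<exists>d>0. \<forall>y. norm (y - x) < d \<longrightarrow> norm (u y - u x - g \<bullet> (y - x)) \<le> e * norm (y - x)"
    using \<open>d > 0\<close> by blast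
qed

theorem Rademacher:
  fixes u :: "'a::euclidean_space \<Rightarrow> real"
  assumes lip: "L-lipschitz_on UNIV u"
  shows "AE x in lborel. \<exists>g. (u has_derivative (\<lambda>h. g \<bullet> h)) (at x)"
proof -
  obtain S :: "'a set" where "countable S" and dense: "\<And>X. open X \<Longrightarrow> X \<noteq> {} \<Longrightarrow> \<exists>d\<in>S. d \<in> X"
    using countable_dense_exists by blast
  have "AE x in lborel. \<forall>v\<in>S. \<forall>D. (\<forall>b\<in>Basis. has_dir_deriv u x b (D b)) \<longrightarrow>
           has_dir_deriv u x (\<Sum>b\<in>Basis. (v \<bullet> b) *\<^sub>R b) (\<Sum>b\<in>Basis. (v \<bullet> b) * D b)"
    unfolding AE_ball_countable[OF \<open>countable S\<close>] by (intro ballI AE_dir_deriv_sum[OF lip]) auto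
  moreover have "AE x in lborel. \<forall>b\<in>Basis. \<exists>l. has_dir_deriv u x b l"
    by (rule AE_finite_allI) (auto intro: AE_ex_dir_deriv[OF lip])
  ultimately show ?thesis
  proof eventually_elim
    case (elim x)
    then obtain D where D: "\<forall>b\<in>Basis. has_dir_deriv u x b (D b)" by metis
    define g where "g = (\<Sum>b\<in>Basis. D b *\<^sub>R b)"
    have "has_dir_deriv u x v (g \<bullet> v)" if "v \<in> S" for v
    proof -
      have "has_dir_deriv u x (\<Sum>b\<in>Basis. (v \<bullet> b) *\<^sub>R b) (\<Sum>b\<in>Basis. (v \<bullet> b) * D b)"
        using elim(1) that D by blast
      moreover have "g \<bullet> v = (\<Sum>b\<in>Basis. (v \<bullet> b) * D b)"
        unfolding g_def inner_sum_left by (simp add: inner_commute[of _ v] mult.commute)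
      ultimately show ?thesis by (simp add: euclidean_representation)
    qed
    with lip dense have "(u has_derivative (\<lambda>h. g \<bullet> h)) (at x)"
      by (rule has_derivative_if_dense_dir_derivs)
    thus ?case ..
  qed
qed

section \<open>Gradients of Lipschitz functions\<close>

lemma grad_eqI:
  assumes "(v has_derivative (\<lambda>h. g \<bullet> h)) (at x)"
  shows "grad v x = g"
  unfolding grad_def
proof (rule some_equality)
  show "(v has_derivative (\<lambda>h. g \<bullet> h)) (at x)" by (rule assms)
  fix k assume "(v has_derivative (\<lambda>h. k \<bullet> h)) (at x)"
  hence "(\<lambda>h. k \<bullet> h) = (\<lambda>h. g \<bullet> h)" using assms by (rule has_derivative_unique)
  thus "k = g" by (metis vector_eq_rdot)
qed

lemma AE_has_derivative_grad:
  assumes "L-lipschitz_on UNIV u"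
  shows "AE x in lborel. (u has_derivative (\<lambda>h. grad u x \<bullet> h)) (at x)"
  using Rademacher[OF assms] by eventually_elim (auto simp: grad_eqI)

lemma has_derivative_imp_has_dir_deriv:
  fixes v :: "'a::euclidean_space \<Rightarrow> real"
  assumes "(v has_derivative (\<lambda>h. k \<bullet> h)) (at x)"
  shows "has_dir_deriv v x w (k \<bullet> w)"
proof -
  have "((\<lambda>t. x + t *\<^sub>R w) has_derivative (\<lambda>t. t *\<^sub>R w)) (at 0)"
    by (auto intro!: derivative_eq_intros)
  moreover have "(v has_derivative (\<lambda>h. k \<bullet> h)) (at (x + 0 *\<^sub>R w))" using assms by simp
  ultimately have "((\<lambda>t. v (x + t *\<^sub>R w)) has_derivative (\<lambda>t. k \<bullet> (t *\<^sub>R w))) (at 0)"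
    by (rule has_derivative_compose)
  hence "((\<lambda>t. v (x + t *\<^sub>R w)) has_real_derivative k \<bullet> w) (at 0)"
    by (simp add: has_field_derivative_def mult_commute_abs)
  thus ?thesis by (simp add: DERIV_def difference_quotient_def[abs_def])
qed

lemma norm_gradient_le_if_quotient_le:
  fixes v :: "'a::euclidean_space \<Rightarrow> real"
  assumes v: "(v has_derivative (\<lambda>h. k \<bullet> h)) (at x)"
    and le: "\<And>t. \<bar>difference_quotient v x k t\<bar> \<le> q t"
    and q: "(q \<longlongrightarrow> l) (at 0)" "l \<le> c * norm k" and "c \<ge> 0"
  shows "norm k \<le> c"
proof -
  have "((\<lambda>t. \<bar>difference_quotient v x k t\<bar>) \<longlongrightarrow> \<bar>k \<bullet> k\<bar>) (at 0)"
    by (intro tendsto_rabs has_derivative_imp_has_dir_deriv v)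
  hence "\<bar>k \<bullet> k\<bar> \<le> l"
    by (rule tendsto_le[OF trivial_limit_at q(1)]) (simp add: le)
  hence "norm k * norm k \<le> c * norm k"
    using q(2) by (simp add: power2_norm_eq_inner flip: power2_eq_square)
  thus ?thesis using \<open>c \<ge> 0\<close> by (cases "k = 0") (auto simp: mult_le_cancel_right)
qed

lemma norm_gradient_le_if_dominated:
  fixes u v :: "'a::euclidean_space \<Rightarrow> real"
  assumes u: "(u has_derivative (\<lambda>h. g \<bullet> h)) (at x)" and v: "(v has_derivative (\<lambda>h. k \<bullet> h)) (at x)"
    and "c \<ge> 0" and dom: "\<And>y. \<bar>v y - v x\<bar> \<le> c * \<bar>u y - u x\<bar>"
  shows "norm k \<le> c * norm g"
proof (rule norm_gradient_le_if_quotient_le[OF v])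
  show "\<bar>difference_quotient v x k t\<bar> \<le> c * \<bar>difference_quotient u x k t\<bar>" for t
    using divide_right_mono[OF dom, of "\<bar>t\<bar>"] by (simp add: difference_quotient_def abs_divide)
  show "((\<lambda>t. c * \<bar>difference_quotient u x k t\<bar>) \<longlongrightarrow> c * \<bar>g \<bullet> k\<bar>) (at 0)"
    by (intro tendsto_intros has_derivative_imp_has_dir_deriv u)
  show "c * \<bar>g \<bullet> k\<bar> \<le> c * norm g * norm k"
    using mult_left_mono[OF Cauchy_Schwarz_ineq2 \<open>c \<ge> 0\<close>] by (simp add: mult.assoc)
qed (use \<open>c \<ge> 0\<close> in simp)

lemma norm_gradient_le_lipschitz:
  fixes v :: "'a::euclidean_space \<Rightarrow> real"
  assumes lip: "L-lipschitz_on UNIV v" and v: "(v has_derivative (\<lambda>h. k \<bullet> h)) (at x)"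
  shows "norm k \<le> L"
proof (rule norm_gradient_le_if_quotient_le[OF v _ tendsto_const order_refl])
  show "\<bar>difference_quotient v x k t\<bar> \<le> L * norm k" for t
    using lipschitz_onD[OF lipschitz_difference_quotient[OF lip], of k 0 x t]
    by (simp add: difference_quotient_def)
qed (rule lipschitz_on_nonneg[OF lip])

lemma AE_norm_grad_le:
  fixes v :: "'a::euclidean_space \<Rightarrow> real"
  assumes lip: "L-lipschitz_on UNIV v"
  shows "AE x in lborel. norm (grad v x) \<le> L"
  using AE_has_derivative_grad[OF lip] by eventually_elim (rule norm_gradient_le_lipschitz[OF lip])

lemma has_derivative_zero_if_zero_on_open:
  fixes v :: "'a::euclidean_space \<Rightarrow> real"
  assumes "open U" "x \<in> U" "\<And>y. y \<in> U \<Longrightarrow> v y = 0"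
  shows "(v has_derivative (\<lambda>h. 0 \<bullet> h)) (at x)"
proof (rule has_derivative_transform_within_open[OF _ assms(1,2)])
  show "((\<lambda>_. 0) has_derivative (\<lambda>h. 0 \<bullet> h)) (at x)" by simp
qed (use assms(3) in simp)

lemma borel_grad_representative:
  fixes v :: "'a::euclidean_space \<Rightarrow> real"
  assumes lip: "L-lipschitz_on UNIV v"
  obtains G where "G \<in> borel_measurable borel" "AE x in lborel. G x = grad v x"
proof
  have [measurable]: "v \<in> borel_measurable borel"
    using lipschitz_on_continuous_on[OF lip] by (rule borel_measurable_continuous_onI)
  define G where
    "G = (\<lambda>x. \<Sum>b\<in>Basis. lim (\<lambda>n. difference_quotient v x b (1 / real (Suc n))) *\<^sub>R (b::'a))"
  show "G \<in> borel_measurable borel"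
    unfolding G_def difference_quotient_def by measurable
  have "filterlim (\<lambda>n. 1 / real (Suc n)) (at 0) sequentially"
    unfolding filterlim_at using LIMSEQ_Suc[OF lim_const_over_n] by auto
  note quotient_lim = filterlim_compose[OF has_derivative_imp_has_dir_deriv this]
  show "AE x in lborel. G x = grad v x"
    using AE_has_derivative_grad[OF lip]
  proof eventually_elim
    case (elim x)
    have "G x = (\<Sum>b\<in>Basis. (grad v x \<bullet> b) *\<^sub>R b)"
      unfolding G_def limI[OF quotient_lim[OF elim]] ..
    thus ?case by (simp add: euclidean_representation)
  qed
qed

lemma borel_measurable_grad:
  fixes v :: "'a::euclidean_space \<Rightarrow> real"
  assumes lip: "L-lipschitz_on UNIV v"
  shows "grad v \<in> borel_measurable lebesgue"
proof -
  obtain G where "G \<in> borel_measurable borel" "AE x in lborel. G x = grad v x"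
    by (rule borel_grad_representative[OF lip])
  hence "G \<in> borel_measurable lebesgue" "AE x in lebesgue. G x = grad v x"
    by (simp_all add: measurable_completion AE_completion_iff)
  thus ?thesis by (rule borel_measurable_AE)
qed

lemma borel_gradient_bounded_supported:
  fixes v :: "'a::euclidean_space \<Rightarrow> real"
  assumes lip: "L-lipschitz_on UNIV v" and "closed K" and supp: "\<And>x. x \<notin> K \<Longrightarrow> v x = 0"
  obtains G where "G \<in> borel_measurable borel" "\<And>x. norm (G x) \<le> L" "\<And>x. x \<notin> K \<Longrightarrow> G x = 0"
    "AE x in lborel. (v has_derivative (\<lambda>h. G x \<bullet> h)) (at x)"
proof -
  obtain G0 where [measurable]: "G0 \<in> borel_measurable borel"
    and G0: "AE x in lborel. G0 x = grad v x"
    by (rule borel_grad_representative[OF lip])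
  define G where "G = (\<lambda>x. if x \<in> K \<and> norm (G0 x) \<le> L then G0 x else 0)"
  have [measurable]: "K \<in> sets borel" using \<open>closed K\<close> by (rule borel_closed)
  have "AE x in lborel. (v has_derivative (\<lambda>h. G x \<bullet> h)) (at x)"
    using G0 AE_has_derivative_grad[OF lip]
  proof eventually_elim
    case (elim x)
    have "G x = grad v x"
    proof (cases "x \<in> K")
      case True
      thus ?thesis using elim norm_gradient_le_lipschitz[OF lip elim(2)] by (simp add: G_def)
    next
      case False
      hence "(v has_derivative (\<lambda>h. 0 \<bullet> h)) (at x)"
        using \<open>closed K\<close> supp by (intro has_derivative_zero_if_zero_on_open[of "- K"]) auto
      hence "grad v x = 0" by (rule grad_eqI)
      thus ?thesis using False by (simp add: G_def)
    qed
    thus ?case using elim(2) by simp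
  qed
  moreover have "G \<in> borel_measurable borel" unfolding G_def by measurable
  moreover have "norm (G x) \<le> L" for x using lipschitz_on_nonneg[OF lip] by (simp add: G_def)
  moreover have "G x = 0" if "x \<notin> K" for x using that by (simp add: G_def)
  ultimately show ?thesis using that by blast
qed

section \<open>Averages over translates\<close>

definition linear_remainder :: "('a::real_inner \<Rightarrow> real) \<Rightarrow> 'a \<Rightarrow> 'a \<Rightarrow> 'a \<Rightarrow> real" where
  "linear_remainder v x g h = (v (x + h) - v x - g \<bullet> h) / norm h"

lemma has_derivative_iff_linear_remainder:
  "(v has_derivative (\<lambda>h. g \<bullet> h)) (at x) \<longleftrightarrow> (linear_remainder v x g \<longlongrightarrow> 0) (at 0)"
proof -
  have "norm (v (x + h) - v x - g \<bullet> h) / norm h = \<bar>linear_remainder v x g h\<bar>" for h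
    by (simp add: linear_remainder_def abs_divide)
  thus ?thesis
    by (simp add: has_derivative_at bounded_linear_inner_right tendsto_rabs_zero_iff)
qed

lemma abs_linear_remainder_le:
  assumes "L-lipschitz_on UNIV v" "norm g \<le> L"
  shows "\<bar>linear_remainder v x g h\<bar> \<le> 2 * L"
proof (cases "h = 0")
  case False
  have "\<bar>v (x + h) - v x\<bar> \<le> L * norm h"
    using lipschitz_onD[OF assms(1), of "x + h" x] by (simp add: dist_norm)
  moreover have "\<bar>g \<bullet> h\<bar> \<le> L * norm h"
    using Cauchy_Schwarz_ineq2[of g h] mult_right_mono[OF assms(2), of "norm h"] by simp
  ultimately have "\<bar>v (x + h) - v x - g \<bullet> h\<bar> \<le> 2 * L * norm h" by linarith
  thus ?thesis using False by (simp add: linear_remainder_def abs_divide divide_le_eq)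
qed (use lipschitz_on_nonneg[OF assms(1)] in \<open>simp add: linear_remainder_def\<close>)

definition translation_average ::
    "'a::real_normed_vector measure \<Rightarrow> ('a \<Rightarrow> 'b::{banach, second_countable_topology}) \<Rightarrow> 'a \<Rightarrow> 'b"
  where
  "translation_average M F x = (LINT y|M. F (x + y))"

locale translation_measure = prob_space M for M :: "'a::euclidean_space measure" +
  assumes sets_eq_borel [measurable_cong]: "sets M = sets borel"
begin

lemma integrable_translate:
  fixes F :: "'a \<Rightarrow> 'b::euclidean_space"
  assumes [measurable]: "F \<in> borel_measurable borel" and "\<And>x. norm (F x) \<le> c"
  shows "integrable M (\<lambda>y. F (x + y))"
  by (rule integrable_const_bound[of _ c]) (auto simp: assms(2))

lemma linear_remainder_translation_average:
  fixes v :: "'a \<Rightarrow> real"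
  assumes v: "v \<in> borel_measurable borel" "\<And>x. \<bar>v x\<bar> \<le> B"
    and G: "G \<in> borel_measurable borel" "\<And>x. norm (G x) \<le> L"
  shows "linear_remainder (translation_average M v) x (translation_average M G x) h =
           (LINT y|M. linear_remainder v (x + y) (G (x + y)) h)"
proof -
  have v_int: "integrable M (\<lambda>y. v (x + y))" for x
    using v by (intro integrable_translate) auto
  have G_int: "integrable M (\<lambda>y. G (x + y))"
    using G by (rule integrable_translate)
  have "(LINT y|M. linear_remainder v (x + y) (G (x + y)) h) =
      (LINT y|M. v (x + h + y) - v (x + y) - G (x + y) \<bullet> h) / norm h"
    by (simp add: linear_remainder_def add.commute add.left_commute)
  also have "(LINT y|M. v (x + h + y) - v (x + y) - G (x + y) \<bullet> h) =
      (LINT y|M. v (x + h + y)) - (LINT y|M. v (x + y)) - (LINT y|M. G (x + y)) \<bullet> h"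
    using v_int G_int by simp
  finally show ?thesis
    unfolding linear_remainder_def[of "translation_average M v"] translation_average_def by simp
qed

lemma has_derivative_translation_average:
  fixes v :: "'a \<Rightarrow> real"
  assumes lip: "L-lipschitz_on UNIV v" and v: "\<And>x. \<bar>v x\<bar> \<le> B"
    and G: "G \<in> borel_measurable borel" "\<And>x. norm (G x) \<le> L"
    and der: "AE y in M. (v has_derivative (\<lambda>h. G (x + y) \<bullet> h)) (at (x + y))"
  shows "(translation_average M v has_derivative (\<lambda>h. translation_average M G x \<bullet> h)) (at x)"
  unfolding has_derivative_iff_linear_remainder tendsto_at_iff_sequentially o_def
proof (intro allI impI)
  fix X :: "nat \<Rightarrow> 'a" assume X: "\<forall>i. X i \<in> UNIV - {0}" "X \<longlonglongrightarrow> 0"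
  have [measurable]: "v \<in> borel_measurable borel"
    using lipschitz_on_continuous_on[OF lip] by (rule borel_measurable_continuous_onI)
  note [measurable] = G(1)
  let ?R = "\<lambda>i y. linear_remainder v (x + y) (G (x + y)) (X i)"
  have "(\<lambda>i. LINT y|M. ?R i y) \<longlonglongrightarrow> (LINT y|M. 0)"
  proof (rule integral_dominated_convergence[where w = "\<lambda>_. 2 * L"])
    show "AE y in M. (\<lambda>i. ?R i y) \<longlonglongrightarrow> 0"
      using der
    proof eventually_elim
      case (elim y)
      thus ?case
        using X unfolding has_derivative_iff_linear_remainder tendsto_at_iff_sequentially o_def
        by blast
    qed
    show "?R i \<in> borel_measurable M" for i unfolding linear_remainder_def by measurable
    show "AE y in M. norm (?R i y) \<le> 2 * L" for i
      by (intro AE_I2) (simp add: abs_linear_remainder_le[OF lip G(2)])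
  qed auto
  thus "(\<lambda>i. linear_remainder (translation_average M v) x (translation_average M G x) (X i)) \<longlonglongrightarrow> 0"
    by (simp add: linear_remainder_translation_average[OF _ v G])
qed

lemma abs_translation_average_diff_le:
  fixes v :: "'a \<Rightarrow> real"
  assumes lip: "L-lipschitz_on UNIV v" and v: "\<And>x. \<bar>v x\<bar> \<le> B" and r: "AE y in M. norm y \<le> r"
  shows "\<bar>translation_average M v x - v x\<bar> \<le> L * r"
proof -
  have "v \<in> borel_measurable borel"
    using lipschitz_on_continuous_on[OF lip] by (rule borel_measurable_continuous_onI)
  hence int: "integrable M (\<lambda>y. v (x + y))"
    using v by (intro integrable_translate) auto
  have "translation_average M v x - v x = (LINT y|M. v (x + y) - v x)"
    using int by (simp add: translation_average_def prob_space)
  hence "\<bar>translation_average M v x - v x\<bar> \<le> (LINT y|M. \<bar>v (x + y) - v x\<bar>)"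
    using integral_abs_bound by simp
  also have "\<dots> \<le> L * r"
  proof (rule integral_le_const)
    show "AE y in M. \<bar>v (x + y) - v x\<bar> \<le> L * r"
      using r
    proof eventually_elim
      case (elim y)
      have "\<bar>v (x + y) - v x\<bar> \<le> L * norm y"
        using lipschitz_onD[OF lip, of "x + y" x] by (simp add: dist_norm)
      also have "\<dots> \<le> L * r" using elim lipschitz_on_nonneg[OF lip] by (rule mult_left_mono)
      finally show ?case .
    qed
  qed (use int in auto)
  finally show ?thesis .
qed

lemma nn_integral_norm_translation_average_le:
  fixes G :: "'a \<Rightarrow> 'b::euclidean_space"
  assumes G [measurable]: "G \<in> borel_measurable borel"
  shows "(\<integral>\<^sup>+x. norm (translation_average M G x) \<partial>lborel) \<le> (\<integral>\<^sup>+x. norm (G x) \<partial>lborel)"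
proof -
  interpret pair_sigma_finite lborel M ..
  have "ennreal (norm (translation_average M G x)) \<le> (\<integral>\<^sup>+y. norm (G (x + y)) \<partial>M)" for x
    by (cases "integrable M (\<lambda>y. G (x + y))")
       (auto simp: translation_average_def not_integrable_integral_eq
         intro: integral_norm_bound_ennreal)
  hence "(\<integral>\<^sup>+x. norm (translation_average M G x) \<partial>lborel) \<le>
      (\<integral>\<^sup>+x. (\<integral>\<^sup>+y. norm (G (x + y)) \<partial>M) \<partial>lborel)"
    by (rule nn_integral_mono)
  also have "\<dots> = (\<integral>\<^sup>+y. (\<integral>\<^sup>+x. norm (G (x + y)) \<partial>lborel) \<partial>M)"
    by (rule Fubini'[symmetric]) measurable
  also have "\<dots> = (\<integral>\<^sup>+y. (\<integral>\<^sup>+x. norm (G x) \<partial>lborel) \<partial>M)"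
    by (simp add: nn_integral_lborel_translate[where f = "\<lambda>x. ennreal (norm (G x))"])
  also have "\<dots> = (\<integral>\<^sup>+x. norm (G x) \<partial>lborel)"
    by (simp add: emeasure_space_1)
  finally show ?thesis .
qed

lemma integral_norm_translation_average_le:
  fixes G :: "'a \<Rightarrow> 'b::euclidean_space"
  assumes G: "integrable lborel G"
  shows "(LINT x|lborel. norm (translation_average M G x)) \<le> (LINT x|lborel. norm (G x))"
proof -
  have [measurable]: "G \<in> borel_measurable borel" using borel_measurable_integrable[OF G] by simp
  have [measurable]: "translation_average M G \<in> borel_measurable borel"
    unfolding translation_average_def by measurable
  have "(\<integral>\<^sup>+x. norm (translation_average M G x) \<partial>lborel) \<le> (\<integral>\<^sup>+x. norm (G x) \<partial>lborel)"
    by (rule nn_integral_norm_translation_average_le) measurable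
  moreover have "(\<integral>\<^sup>+x. norm (G x) \<partial>lborel) < top"
    using G by (simp add: integrable_iff_bounded)
  ultimately show ?thesis
    by (subst (1 2) integral_eq_nn_integral) (auto intro: enn2real_mono)
qed

end

abbreviation ball_average ::
    "real \<Rightarrow> ('a::euclidean_space \<Rightarrow> 'b::euclidean_space) \<Rightarrow> 'a \<Rightarrow> 'b" where
  "ball_average r \<equiv> translation_average (uniform_measure lborel (cball 0 r))"

lemma emeasure_lborel_cball_nonzero_finite:
  assumes "r > 0"
  shows "emeasure lborel (cball (a::'a::euclidean_space) r) \<noteq> 0"
    and "emeasure lborel (cball (a::'a::euclidean_space) r) \<noteq> \<infinity>"
proof -
  have "measure lborel (cball a r) > 0"
    using content_cball_pos[OF assms, of a] by simp
  thus "emeasure lborel (cball a r) \<noteq> 0" by (auto simp: measure_def)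
  show "emeasure lborel (cball a r) \<noteq> \<infinity>"
    using emeasure_lborel_cball_finite[of a r] by auto
qed

lemma translation_measure_uniform_cball:
  assumes "r > 0"
  shows "translation_measure (uniform_measure lborel (cball (0::'a::euclidean_space) r))"
proof -
  have "prob_space (uniform_measure lborel (cball (0::'a) r))"
    using emeasure_lborel_cball_nonzero_finite[OF assms] by (rule prob_space_uniform_measure)
  thus ?thesis by (simp add: translation_measure_def translation_measure_axioms_def)
qed

lemma AE_uniform_cball:
  "AE y in uniform_measure lborel (cball (0::'a::euclidean_space) r). norm y \<le> r"
  by (rule AE_uniform_measureI) auto

lemma ball_average_eq_zero_if_supported:
  assumes "\<And>x. x \<notin> K \<Longrightarrow> F x = 0" "x \<notin> (\<Union>x\<in>K. cball x r)"
  shows "ball_average r F x = 0"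
proof -
  have "F (x + y) = 0" if "norm y \<le> r" for y
    by (rule assms(1)) (use assms(2) that in \<open>auto simp: dist_norm\<close>)
  thus ?thesis
    unfolding translation_average_def
    by (intro integral_eq_zero_AE eventually_mono[OF AE_uniform_cball])
qed

lemma integral_uniform_measure:
  fixes F :: "'a \<Rightarrow> 'b::{banach, second_countable_topology}"
  assumes A [measurable]: "A \<in> sets M" "emeasure M A \<noteq> 0" "emeasure M A \<noteq> \<infinity>"
    and [measurable]: "F \<in> borel_measurable M"
  shows "(LINT x|uniform_measure M A. F x) = (LINT x:A|M. F x) /\<^sub>R measure M A"
proof -
  have m: "emeasure M A = ennreal (measure M A)" "measure M A > 0"
    using A(2,3)
    by (auto simp: emeasure_eq_ennreal_measure zero_less_measure_iff top.not_eq_extremum)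
  have "uniform_measure M A = density M (\<lambda>x. ennreal (indicator A x / measure M A))"
    unfolding uniform_measure_def m(1) using m(2)
    by (intro density_cong) (auto simp: indicator_def divide_ennreal simp flip: ennreal_1)
  thus ?thesis
    by (simp add: integral_density set_lebesgue_integral_def divide_inverse
        mult.commute[of "indicator A _"] flip: scaleR_scaleR)
qed

lemma integral_lborel_translate:
  fixes F :: "'a::euclidean_space \<Rightarrow> 'b::euclidean_space"
  assumes "F \<in> borel_measurable borel"
  shows "(LINT y|lborel. F (x + y)) = (LINT y|lborel. F y)"
proof -
  have "(LINT y|lborel. F y) = (LINT y|distr lborel borel ((+) x). F y)"
    by (simp add: lborel_distr_plus)
  also have "\<dots> = (LINT y|lborel. F (x + y))"
    using assms by (subst integral_distr) auto
  finally show ?thesis by simp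
qed

lemma ball_average_eq:
  fixes F :: "'a::euclidean_space \<Rightarrow> 'b::euclidean_space"
  assumes [measurable]: "F \<in> borel_measurable borel" and "r > 0"
  shows "ball_average r F x = (LINT z:cball x r|lborel. F z) /\<^sub>R measure lborel (cball (0::'a) r)"
proof -
  have "ball_average r F x =
      (LINT y:cball 0 r|lborel. F (x + y)) /\<^sub>R measure lborel (cball (0::'a) r)"
    unfolding translation_average_def
    using emeasure_lborel_cball_nonzero_finite[OF \<open>r > 0\<close>] by (intro integral_uniform_measure) auto
  also have "(LINT y:cball 0 r|lborel. F (x + y)) =
      (LINT y|lborel. indicator (cball x r) (x + y) *\<^sub>R F (x + y))"
    unfolding set_lebesgue_integral_def
    by (intro Bochner_Integration.integral_cong) (auto simp: indicator_def dist_norm)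
  also have "\<dots> = (LINT z:cball x r|lborel. F z)"
    unfolding set_lebesgue_integral_def
    by (intro integral_lborel_translate borel_measurable_scaleR borel_measurable_indicator
        borel_closed closed_cball assms(1))
  finally show ?thesis .
qed

lemma continuous_set_integral_cball:
  fixes F :: "'a::euclidean_space \<Rightarrow> 'b::euclidean_space"
  assumes F: "integrable lborel F"
  shows "continuous_on UNIV (\<lambda>x. LINT z:cball x r|lborel. F z)"
proof (rule continuous_on_sequentiallyI)
  fix X and x :: 'a assume X: "X \<longlonglongrightarrow> x"
  have [measurable]: "F \<in> borel_measurable borel" using borel_measurable_integrable[OF F] by simp
  have "AE z in lborel. z \<notin> sphere x r"
    by (intro AE_lborel_not_in_negligible negligible_sphere)
  hence lim: "AE z in lborel.
      (\<lambda>i. indicator (cball (X i) r) z *\<^sub>R F z) \<longlonglongrightarrow> indicator (cball x r) z *\<^sub>R F z"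
  proof eventually_elim
    case (elim z)
    have "(\<lambda>i. dist (X i) z) \<longlonglongrightarrow> dist x z" by (intro tendsto_intros X)
    note near = order_tendstoD[OF this]
    have "\<forall>\<^sub>F i in sequentially. dist (X i) z \<le> r \<longleftrightarrow> dist x z \<le> r"
    proof (cases "dist x z" r rule: linorder_cases)
      case less
      from near(2)[OF this] show ?thesis by eventually_elim (use less in simp)
    next
      case greater
      from near(1)[OF this] show ?thesis by eventually_elim (use greater in simp)
    qed (use elim in simp)
    hence "\<forall>\<^sub>F i in sequentially.
        indicator (cball (X i) r) z *\<^sub>R F z = indicator (cball x r) z *\<^sub>R F z"
      by eventually_elim (simp add: indicator_def)
    thus ?case by (rule tendsto_eventually)
  qed
  show "(\<lambda>i. LINT z:cball (X i) r|lborel. F z) \<longlonglongrightarrow> (LINT z:cball x r|lborel. F z)"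
    unfolding set_lebesgue_integral_def
    by (rule integral_dominated_convergence[OF _ _ integrable_norm[OF F] lim])
       (auto simp: indicator_def)
qed

lemma continuous_ball_average:
  fixes F :: "'a::euclidean_space \<Rightarrow> 'b::euclidean_space"
  assumes "integrable lborel F" "r > 0"
  shows "continuous_on UNIV (ball_average r F)"
proof -
  have "F \<in> borel_measurable borel" using borel_measurable_integrable[OF assms(1)] by simp
  hence "ball_average r F =
      (\<lambda>x. (LINT z:cball x r|lborel. F z) /\<^sub>R measure lborel (cball (0::'a) r))"
    using ball_average_eq \<open>r > 0\<close> by blast
  thus ?thesis
    by (simp add: continuous_intros continuous_set_integral_cball[OF assms(1)])
qed

section \<open>The Cheeger inequality for Lipschitz functions\<close>

lemma lipschitz_on_if_dominated:
  fixes u w :: "'a::metric_space \<Rightarrow> real"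
  assumes "L-lipschitz_on UNIV u" "c \<ge> 0" and dom: "\<And>x y. \<bar>w x - w y\<bar> \<le> c * \<bar>u x - u y\<bar>"
  shows "(c * L)-lipschitz_on UNIV w"
proof (rule lipschitz_onI)
  fix x y :: 'a
  have "c * \<bar>u x - u y\<bar> \<le> c * (L * dist x y)"
    using lipschitz_onD[OF assms(1), of x y] \<open>c \<ge> 0\<close>
    by (intro mult_left_mono) (auto simp: dist_real_def)
  thus "dist (w x) (w y) \<le> c * L * dist x y"
    using dom[of x y] by (simp add: dist_real_def mult.assoc)
qed (use \<open>c \<ge> 0\<close> lipschitz_on_nonneg[OF assms(1)] in simp)

lemma lipschitz_bounded_if_bounded_support:
  fixes v :: "'a::euclidean_space \<Rightarrow> real"
  assumes "L-lipschitz_on UNIV v" "bounded A" and supp: "\<And>x. x \<notin> A \<Longrightarrow> v x = 0"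
  obtains B where "\<And>x. \<bar>v x\<bar> \<le> B"
proof -
  have "bounded (v ` closure A)"
    using assms(2) lipschitz_on_continuous_on[OF assms(1)]
    by (intro compact_imp_bounded compact_continuous_image) (auto intro: continuous_on_subset)
  then obtain B where "B > 0" "\<And>x. x \<in> closure A \<Longrightarrow> \<bar>v x\<bar> \<le> B" by (auto simp: bounded_pos)
  hence "\<bar>v x\<bar> \<le> B" for x
    using supp[of x] closure_subset[of A] by (cases "x \<in> A") auto
  thus ?thesis by (rule that)
qed

lemma integral_norm_grad_eq_if_supported:
  fixes v :: "'a::euclidean_space \<Rightarrow> real"
  assumes [measurable]: "G \<in> borel_measurable borel"
    and der: "AE x in lborel. (v has_derivative (\<lambda>h. G x \<bullet> h)) (at x)"
    and supp: "\<And>x. x \<notin> \<Omega> \<Longrightarrow> G x = 0"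
  shows "(LINT x:\<Omega>|lebesgue. norm (grad v x)) = (LINT x|lborel. norm (G x))"
proof -
  have "AE x in lborel. norm (G x) = indicator \<Omega> x *\<^sub>R norm (grad v x)"
    using der by eventually_elim (auto simp: grad_eqI supp indicator_def)
  hence ae: "AE x in lebesgue. norm (G x) = indicator \<Omega> x *\<^sub>R norm (grad v x)"
    by (simp add: AE_completion_iff)
  have G: "(\<lambda>x. norm (G x)) \<in> borel_measurable lborel" by measurable
  hence "(LINT x|lborel. norm (G x)) = (LINT x|lebesgue. norm (G x))"
    by (rule integral_completion[symmetric])
  also have "\<dots> = (LINT x:\<Omega>|lebesgue. norm (grad v x))"
    unfolding set_lebesgue_integral_def
    using measurable_completion[OF G] borel_measurable_AE[OF measurable_completion[OF G] ae] ae
    by (rule integral_cong_AE)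
  finally show ?thesis by simp
qed

lemma compact_UN_cball:
  fixes K :: "'a::euclidean_space set"
  assumes "compact K"
  shows "compact (\<Union>x\<in>K. cball x r)"
proof -
  have "(\<Union>x\<in>K. cball x r) = {x + y |x y. x \<in> K \<and> y \<in> cball 0 r}"
  proof safe
    fix x z assume "x \<in> K" "z \<in> cball x r"
    thus "\<exists>a b. z = a + b \<and> a \<in> K \<and> b \<in> cball 0 r"
      by (intro exI[of _ x] exI[of _ "z - x"]) (auto simp: dist_norm norm_minus_commute)
  next
    fix x y :: 'a assume "x \<in> K" "y \<in> cball 0 r"
    thus "x + y \<in> (\<Union>x\<in>K. cball x r)" by (intro UN_I[of x]) (auto simp: dist_norm)
  qed
  thus ?thesis using compact_sums[OF assms compact_cball[of 0 r]] by (simp only:)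
qed

lemma compact_support_subset:
  fixes \<phi> :: "'a::euclidean_space \<Rightarrow> real"
  assumes "compact K" "\<And>x. x \<notin> K \<Longrightarrow> \<phi> x = 0"
  shows "compact (closure {x. \<phi> x \<noteq> 0})" "closure {x. \<phi> x \<noteq> 0} \<subseteq> K"
proof -
  show "closure {x. \<phi> x \<noteq> 0} \<subseteq> K"
    using assms by (intro closure_minimal compact_imp_closed) auto
  thus "compact (closure {x. \<phi> x \<noteq> 0})"
    using compact_Int_closed[OF assms(1) closed_closure, of "{x. \<phi> x \<noteq> 0}"]
    by (simp add: Int_absorb1)
qed

lemma ball_average_gradient:
  fixes v :: "'a::euclidean_space \<Rightarrow> real"
  assumes lip: "L-lipschitz_on UNIV v" and K: "compact K" "K \<subseteq> \<Omega>"
    and supp: "\<And>x. x \<notin> K \<Longrightarrow> v x = 0" and "r > 0"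
  obtains g where "continuous_on UNIV g"
    "\<And>x. (ball_average r v has_derivative (\<lambda>h. g x \<bullet> h)) (at x)"
    "\<And>x. x \<notin> (\<Union>x\<in>K. cball x r) \<Longrightarrow> g x = 0"
    "(LINT x|lborel. norm (g x)) \<le> (LINT x:\<Omega>|lebesgue. norm (grad v x))"
proof -
  interpret translation_measure "uniform_measure lborel (cball (0::'a) r)"
    using \<open>r > 0\<close> by (rule translation_measure_uniform_cball)
  obtain B where B: "\<And>x. \<bar>v x\<bar> \<le> B"
    using lipschitz_bounded_if_bounded_support[OF lip compact_imp_bounded[OF K(1)] supp] by blast
  obtain G where G [measurable]: "G \<in> borel_measurable borel" and GL: "\<And>x. norm (G x) \<le> L"
    and GK: "\<And>x. x \<notin> K \<Longrightarrow> G x = 0"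
    and Gv: "AE x in lborel. (v has_derivative (\<lambda>h. G x \<bullet> h)) (at x)"
    using borel_gradient_bounded_supported[OF lip compact_imp_closed[OF K(1)] supp] by blast
  have G_int: "integrable lborel G"
    using K(1)
    by (intro integrableI_bounded_set[of K _ _ L] emeasure_bounded_finite compact_imp_bounded)
      (auto simp: GL GK borel_compact)
  have "AE y in uniform_measure lborel (cball 0 r).
      (v has_derivative (\<lambda>h. G (x + y) \<bullet> h)) (at (x + y))" for x
    using AE_lborel_translate[OF Gv, of x]
    by (intro AE_uniform_measureI) (auto elim: eventually_mono)
  hence "(ball_average r v has_derivative (\<lambda>h. ball_average r G x \<bullet> h)) (at x)" for x
    by (rule has_derivative_translation_average[OF lip B G GL])
  moreover have "continuous_on UNIV (ball_average r G)"
    by (rule continuous_ball_average[OF G_int \<open>r > 0\<close>])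
  moreover have "ball_average r G x = 0" if "x \<notin> (\<Union>x\<in>K. cball x r)" for x
    using GK that by (rule ball_average_eq_zero_if_supported)
  moreover have "(LINT x|lborel. norm (G x)) = (LINT x:\<Omega>|lebesgue. norm (grad v x))"
    using G Gv by (rule integral_norm_grad_eq_if_supported[symmetric]) (use GK K(2) in blast)
  hence "(LINT x|lborel. norm (ball_average r G x)) \<le> (LINT x:\<Omega>|lebesgue. norm (grad v x))"
    using integral_norm_translation_average_le[OF G_int] by simp
  ultimately show ?thesis by (intro that[of "ball_average r G"])
qed

lemma ball_average_C1_0:
  fixes v :: "'a::euclidean_space \<Rightarrow> real"
  assumes lip: "L-lipschitz_on UNIV v" and K: "compact K" and supp: "\<And>x. x \<notin> K \<Longrightarrow> v x = 0"
    and r: "r > 0" "(\<Union>x\<in>K. cball x r) \<subseteq> \<Omega>"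
  shows "ball_average r v \<in> C1_0 \<Omega>"
    and "(LINT x:\<Omega>|lebesgue. norm (grad (ball_average r v) x)) \<le>
           (LINT x:\<Omega>|lebesgue. norm (grad v x))"
proof -
  have "K \<subseteq> \<Omega>" using r by force
  obtain g where cont: "continuous_on UNIV g"
    and der: "\<And>x. (ball_average r v has_derivative (\<lambda>h. g x \<bullet> h)) (at x)"
    and g_zero: "\<And>x. x \<notin> (\<Union>x\<in>K. cball x r) \<Longrightarrow> g x = 0"
    and g_le: "(LINT x|lborel. norm (g x)) \<le> (LINT x:\<Omega>|lebesgue. norm (grad v x))"
    by (rule ball_average_gradient[OF lip K \<open>K \<subseteq> \<Omega>\<close> supp r(1)]) (assumption, rule that)
  have "ball_average r v x = 0" if "x \<notin> (\<Union>x\<in>K. cball x r)" for x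
    using supp that by (rule ball_average_eq_zero_if_supported)
  note supp_subset =
    compact_support_subset[OF compact_UN_cball[OF K], of r "ball_average r v", OF this]
  show "ball_average r v \<in> C1_0 \<Omega>"
    unfolding C1_0_def
  proof (intro CollectI conjI exI allI)
    show "closure {x. ball_average r v x \<noteq> 0} \<subseteq> \<Omega>" using supp_subset(2) r(2) by (rule order_trans)
  qed (rule cont der supp_subset(1))+
  have "(LINT x:\<Omega>|lebesgue. norm (grad (ball_average r v) x)) = (LINT x|lborel. norm (g x))"
    using borel_measurable_continuous_onI[OF cont] AE_I2[OF der]
    by (rule integral_norm_grad_eq_if_supported) (use g_zero r(2) in blast)
  thus "(LINT x:\<Omega>|lebesgue. norm (grad (ball_average r v) x)) \<le>
           (LINT x:\<Omega>|lebesgue. norm (grad v x))"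
    using g_le by simp
qed

lemma C1_0_approximation_if_compact_support:
  fixes v :: "'a::euclidean_space \<Rightarrow> real"
  assumes lip: "L-lipschitz_on UNIV v" and K: "compact K" "K \<subseteq> \<Omega>" and "open \<Omega>"
    and supp: "\<And>x. x \<notin> K \<Longrightarrow> v x = 0" and "e > 0"
  obtains \<phi> where "\<phi> \<in> C1_0 \<Omega>" "\<And>x. \<bar>\<phi> x - v x\<bar> \<le> e"
    "(LINT x:\<Omega>|lebesgue. norm (grad \<phi> x)) \<le> (LINT x:\<Omega>|lebesgue. norm (grad v x))"
proof -
  obtain d where "d > 0" and d: "(\<Union>x\<in>K. cball x d) \<subseteq> \<Omega>"
    using compact_subset_open_imp_cball_epsilon_subset[OF K(1) \<open>open \<Omega>\<close> K(2)] by blast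
  have L: "L \<ge> 0" using lip by (rule lipschitz_on_nonneg)
  define r where "r = min d (e / (L + 1))"
  have r: "r > 0" "(\<Union>x\<in>K. cball x r) \<subseteq> \<Omega>"
    using \<open>d > 0\<close> \<open>e > 0\<close> L d by (force simp: r_def)+
  have "L * r \<le> L * (e / (L + 1))" using L by (intro mult_left_mono) (auto simp: r_def)
  also have "\<dots> \<le> e" using L \<open>e > 0\<close> by (simp add: field_simps)
  finally have "L * r \<le> e" .
  interpret translation_measure "uniform_measure lborel (cball (0::'a) r)"
    using r(1) by (rule translation_measure_uniform_cball)
  obtain B where B: "\<And>x. \<bar>v x\<bar> \<le> B"
    using lipschitz_bounded_if_bounded_support[OF lip compact_imp_bounded[OF K(1)] supp] by blast
  have "\<bar>ball_average r v x - v x\<bar> \<le> e" for x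
    using abs_translation_average_diff_le[OF lip B AE_uniform_cball, of x] \<open>L * r \<le> e\<close> by simp
  thus ?thesis using that ball_average_C1_0[OF lip K(1) supp r] by blast
qed

lemma W1inf0E:
  assumes "u \<in> W1inf0 \<Omega>"
  obtains L where "L-lipschitz_on UNIV u" "\<And>x. x \<notin> \<Omega> \<Longrightarrow> u x = 0"
  using assms by (auto simp: W1inf0_def)

lemma zero_in_W1inf0: "(\<lambda>_. 0) \<in> W1inf0 \<Omega>"
  by (auto simp: W1inf0_def intro: lipschitz_on_constant)

lemma W1inf0_if_dominated:
  assumes "u \<in> W1inf0 \<Omega>" "c \<ge> 0"
    and "\<And>x y. \<bar>w x - w y\<bar> \<le> c * \<bar>u x - u y\<bar>" "\<And>x. x \<notin> \<Omega> \<Longrightarrow> w x = 0"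
  shows "w \<in> W1inf0 \<Omega>"
proof -
  obtain L where "L-lipschitz_on UNIV u" using W1inf0E[OF assms(1)] by blast
  hence "(c * L)-lipschitz_on UNIV w" using assms(2,3) by (rule lipschitz_on_if_dominated)
  thus ?thesis using assms(4) by (auto simp: W1inf0_def)
qed

lemma AE_norm_grad_le_if_dominated:
  assumes "u \<in> W1inf0 \<Omega>" "w \<in> W1inf0 \<Omega>" "c \<ge> 0" "\<And>x y. \<bar>w x - w y\<bar> \<le> c * \<bar>u x - u y\<bar>"
  shows "AE x in lebesgue. norm (grad w x) \<le> c * norm (grad u x)"
proof -
  obtain L L' where "L-lipschitz_on UNIV u" "L'-lipschitz_on UNIV w"
    using assms(1,2) by (auto elim!: W1inf0E)
  hence "AE x in lborel. (u has_derivative (\<lambda>h. grad u x \<bullet> h)) (at x)"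
    "AE x in lborel. (w has_derivative (\<lambda>h. grad w x \<bullet> h)) (at x)"
    by (auto intro: AE_has_derivative_grad)
  hence "AE x in lborel. norm (grad w x) \<le> c * norm (grad u x)"
    by eventually_elim (rule norm_gradient_le_if_dominated[OF _ _ assms(3,4)])
  thus ?thesis by (simp add: AE_completion_iff)
qed

lemma C1_0_subset_W1inf0: "C1_0 \<Omega> \<subseteq> W1inf0 \<Omega>"
proof
  fix \<phi> :: "'a \<Rightarrow> real" assume "\<phi> \<in> C1_0 \<Omega>"
  then obtain g where g: "continuous_on UNIV g" "\<And>x. (\<phi> has_derivative (\<lambda>h. g x \<bullet> h)) (at x)"
    and "compact (closure {x. \<phi> x \<noteq> 0})" "closure {x. \<phi> x \<noteq> 0} \<subseteq> \<Omega>"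
    by (auto simp: C1_0_def)
  then obtain K where K: "compact K" "K \<subseteq> \<Omega>" and zero: "\<And>x. x \<notin> K \<Longrightarrow> \<phi> x = 0"
    using closure_subset[of "{x. \<phi> x \<noteq> 0}"] by blast
  have "bounded (g ` K)"
    using K(1) g(1)
    by (intro compact_imp_bounded compact_continuous_image) (auto intro: continuous_on_subset)
  then obtain B where B: "B > 0" "\<And>x. x \<in> K \<Longrightarrow> norm (g x) \<le> B" by (auto simp: bounded_pos)
  have "norm (g x) \<le> B" for x
  proof (cases "x \<in> K")
    case False
    hence "(\<phi> has_derivative (\<lambda>h. 0 \<bullet> h)) (at x)"
      by (intro has_derivative_zero_if_zero_on_open[of "- K"])
         (auto simp: zero K(1) compact_imp_closed)
    hence "grad \<phi> x = 0" by (rule grad_eqI)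
    hence "g x = 0" using grad_eqI[OF g(2)] by simp
    thus ?thesis using B(1) by simp
  qed (rule B(2))
  hence "norm (g x \<bullet> h) \<le> B * norm h" for x h
    using Cauchy_Schwarz_ineq2[of "g x" h] mult_right_mono[of "norm (g x)" B "norm h"] by force
  hence "onorm (\<lambda>h. g x \<bullet> h) \<le> B" for x by (rule onorm_le)
  hence "B-lipschitz_on UNIV \<phi>"
    using g(2) B(1) by (intro bounded_derivative_imp_lipschitz[where f' = "\<lambda>x h. g x \<bullet> h"]) auto
  thus "\<phi> \<in> W1inf0 \<Omega>" using zero K(2) by (auto simp: W1inf0_def)
qed

lemma set_integral_nonneg_real:
  fixes F :: "'a \<Rightarrow> real"
  assumes "\<And>x. F x \<ge> 0"
  shows "(LINT x:A|M. F x) \<ge> 0"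
  unfolding set_lebesgue_integral_def using assms by (intro integral_nonneg_AE) simp

lemma AE_zero_if_set_integral_nonpos:
  fixes F :: "'a \<Rightarrow> real"
  assumes "set_integrable M A F" and nonneg: "\<And>x. F x \<ge> 0" and "(LINT x:A|M. F x) \<le> 0"
  shows "AE x \<in> A in M. F x = 0"
proof -
  have "integral\<^sup>L M (\<lambda>x. indicator A x *\<^sub>R F x) = 0"
    using assms(3) set_integral_nonneg_real[OF nonneg, of M A]
    unfolding set_lebesgue_integral_def by (rule antisym)
  hence "AE x in M. indicator A x *\<^sub>R F x = 0"
    using assms(1) nonneg
    by (subst (asm) integral_nonneg_eq_0_iff_AE) (auto simp: set_integrable_def)
  thus ?thesis by eventually_elim (simp add: indicator_def)
qed

locale bounded_open_set =
  fixes \<Omega> :: "'a::euclidean_space set"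
  assumes open_set: "open \<Omega>" and bounded_set: "bounded \<Omega>"
begin

lemma Omega_in_sets_lebesgue [measurable]: "\<Omega> \<in> sets lebesgue"
  using open_set by (simp add: borel_open)

lemma emeasure_lebesgue_finite: "emeasure lebesgue \<Omega> < \<infinity>"
  using emeasure_bounded_finite[OF bounded_set] open_set
  by (simp add: emeasure_completion borel_open)

lemma set_integrable_if_AE_bounded:
  fixes F :: "'a \<Rightarrow> real"
  assumes "F \<in> borel_measurable lebesgue" "AE x in lebesgue. \<bar>F x\<bar> \<le> c"
  shows "set_integrable lebesgue \<Omega> F"
  unfolding set_integrable_def
  using assms Omega_in_sets_lebesgue emeasure_lebesgue_finite
  by (intro integrableI_bounded_set_indicator[where B = c]) auto

lemma set_integrable_W1inf0:
  assumes u: "u \<in> W1inf0 \<Omega>"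
  shows "set_integrable lebesgue \<Omega> u" "set_integrable lebesgue \<Omega> (\<lambda>x. norm (grad u x))"
proof -
  obtain L where lip: "L-lipschitz_on UNIV u" and supp: "\<And>x. x \<notin> \<Omega> \<Longrightarrow> u x = 0"
    using W1inf0E[OF u] by blast
  obtain B where "\<And>x. \<bar>u x\<bar> \<le> B"
    using lipschitz_bounded_if_bounded_support[OF lip bounded_set supp] by blast
  moreover have "u \<in> borel_measurable borel"
    using lipschitz_on_continuous_on[OF lip] by (rule borel_measurable_continuous_onI)
  ultimately show "set_integrable lebesgue \<Omega> u"
    by (intro set_integrable_if_AE_bounded measurable_completion) auto
  have [measurable]: "grad u \<in> borel_measurable lebesgue" by (rule borel_measurable_grad[OF lip])
  have "AE x in lebesgue. \<bar>norm (grad u x)\<bar> \<le> L"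
    using AE_norm_grad_le[OF lip] by (simp add: AE_completion_iff)
  thus "set_integrable lebesgue \<Omega> (\<lambda>x. norm (grad u x))"
    by (intro set_integrable_if_AE_bounded) measurable
qed

lemma set_integrable_abs_W1inf0:
  "u \<in> W1inf0 \<Omega> \<Longrightarrow> set_integrable lebesgue \<Omega> (\<lambda>x. \<bar>u x\<bar>)"
  by (intro set_integrable_abs set_integrable_W1inf0)

lemma set_integral_norm_grad_le_if_dominated:
  assumes "u \<in> W1inf0 \<Omega>" "w \<in> W1inf0 \<Omega>" "\<And>x y. \<bar>w x - w y\<bar> \<le> \<bar>u x - u y\<bar>"
  shows "(LINT x:\<Omega>|lebesgue. norm (grad w x)) \<le> (LINT x:\<Omega>|lebesgue. norm (grad u x))"
  using AE_norm_grad_le_if_dominated[OF assms(1,2), of 1] assms(3)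
  by (intro set_integral_mono_AE set_integrable_W1inf0 assms(1,2)) auto

text \<open>Truncation moves the support of \<open>u\<close> into a compact subset of \<open>\<Omega>\<close>.\<close>
lemma C1_0_approximation:
  assumes u: "u \<in> W1inf0 \<Omega>" and "e > 0"
  obtains \<phi> where "\<phi> \<in> C1_0 \<Omega>" "\<And>x. \<bar>\<phi> x - u x\<bar> \<le> e"
    "(LINT x:\<Omega>|lebesgue. norm (grad \<phi> x)) \<le> (LINT x:\<Omega>|lebesgue. norm (grad u x))"
proof -
  obtain L where lip: "L-lipschitz_on UNIV u" and supp: "\<And>x. x \<notin> \<Omega> \<Longrightarrow> u x = 0"
    using W1inf0E[OF u] by blast
  define w where "w = (\<lambda>x. u x - max (- (e / 2)) (min (e / 2) (u x)))"
  have dom: "\<bar>w x - w y\<bar> \<le> \<bar>u x - u y\<bar>" for x y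
    by (auto simp: w_def max_def min_def)
  have near: "\<bar>w x - u x\<bar> \<le> e / 2" for x
    using \<open>e > 0\<close> by (auto simp: w_def max_def min_def)
  define K where "K = closure \<Omega> \<inter> {x. \<bar>u x\<bar> \<ge> e / 2}"
  have "compact K"
    unfolding K_def using bounded_set
    by (intro compact_Int_closed closed_Collect_le continuous_intros
        lipschitz_on_continuous_on[OF lip]) auto
  have "K \<subseteq> \<Omega>" using supp \<open>e > 0\<close> by (fastforce simp: K_def)
  have wK: "w x = 0" if "x \<notin> K" for x
  proof -
    have "\<bar>u x\<bar> < e / 2"
      using that supp[of x] \<open>e > 0\<close> closure_subset[of \<Omega>] by (cases "x \<in> \<Omega>") (auto simp: K_def)
    thus ?thesis by (simp add: w_def)
  qed
  have w_lip: "L-lipschitz_on UNIV w" using lipschitz_on_if_dominated[OF lip, of 1 w] dom by simp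
  obtain \<phi> where \<phi>: "\<phi> \<in> C1_0 \<Omega>" "\<And>x. \<bar>\<phi> x - w x\<bar> \<le> e / 2"
      "(LINT x:\<Omega>|lebesgue. norm (grad \<phi> x)) \<le> (LINT x:\<Omega>|lebesgue. norm (grad w x))"
    using C1_0_approximation_if_compact_support[OF w_lip \<open>compact K\<close> \<open>K \<subseteq> \<Omega>\<close> open_set wK]
      half_gt_zero[OF \<open>e > 0\<close>] by blast
  have "\<bar>\<phi> x - u x\<bar> \<le> e" for x using \<phi>(2)[of x] near[of x] by linarith
  moreover have "w \<in> W1inf0 \<Omega>"
    using W1inf0_if_dominated[OF u, of 1 w] dom wK \<open>K \<subseteq> \<Omega>\<close> by auto
  ultimately show ?thesis
    using that \<phi>(1,3) set_integral_norm_grad_le_if_dominated[OF u _ dom] by (meson order_trans)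
qed

lemma ex_C1_0_nonzero:
  assumes "\<Omega> \<noteq> {}"
  shows "\<exists>\<phi>\<in>C1_0 \<Omega>. \<exists>x. \<phi> x \<noteq> 0"
proof -
  obtain a where "a \<in> \<Omega>" using assms by blast
  define v where "v = (\<lambda>x. infdist x (- \<Omega>))"
  have "\<Omega> \<noteq> UNIV" using bounded_set not_bounded_UNIV by auto
  hence "v a > 0"
    using open_set \<open>a \<in> \<Omega>\<close> infdist_pos_not_in_closed[of "- \<Omega>" a] by (auto simp: v_def)
  have "1-lipschitz_on UNIV v"
    by (rule lipschitz_onI) (simp_all add: v_def dist_real_def infdist_triangle_abs)
  hence "v \<in> W1inf0 \<Omega>" by (auto simp: W1inf0_def v_def)
  then obtain \<phi> where "\<phi> \<in> C1_0 \<Omega>" "\<bar>\<phi> a - v a\<bar> \<le> v a / 2"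
    using C1_0_approximation[of v "v a / 2"] \<open>v a > 0\<close> by auto
  moreover from this have "\<phi> a \<noteq> 0" using \<open>v a > 0\<close> by auto
  ultimately show ?thesis by blast
qed

lemma zero_if_set_integral_abs_le_zero:
  assumes u: "u \<in> W1inf0 \<Omega>" and "(LINT x:\<Omega>|lebesgue. \<bar>u x\<bar>) \<le> 0" and "x \<in> \<Omega>"
  shows "u x = 0"
proof -
  have "AE x \<in> \<Omega> in lebesgue. \<bar>u x\<bar> = 0"
    using assms(2) by (intro AE_zero_if_set_integral_nonpos set_integrable_abs_W1inf0[OF u]) auto
  hence "AE x \<in> \<Omega> in lebesgue. x \<in> {x. u x = 0}" by simp
  moreover have "closed {x. u x = 0}"
    using u lipschitz_on_continuous_on by (intro closed_Collect_eq) (auto elim!: W1inf0E)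
  ultimately show ?thesis
    using mem_closed_if_AE_lebesgue_open[OF open_set _ _ \<open>x \<in> \<Omega>\<close>] by blast
qed

lemma le_cheeger_iff:
  assumes "\<Omega> \<noteq> {}"
  shows "c \<le> cheeger \<Omega> \<longleftrightarrow>
    (\<forall>\<phi>\<in>C1_0 \<Omega>. c * (LINT x:\<Omega>|lebesgue. \<bar>\<phi> x\<bar>) \<le> (LINT x:\<Omega>|lebesgue. norm (grad \<phi> x)))"
    (is "_ \<longleftrightarrow> (\<forall>\<phi>\<in>C1_0 \<Omega>. c * ?J \<phi> \<le> ?P \<phi>)")
proof -
  let ?Q = "{?P \<phi> / ?J \<phi> |\<phi>. \<phi> \<in> C1_0 \<Omega> \<and> (\<exists>x. \<phi> x \<noteq> 0)}"
  have nonneg: "?J \<phi> \<ge> 0" "?P \<phi> \<ge> 0" for \<phi> :: "'a \<Rightarrow> real"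
    by (rule set_integral_nonneg_real, simp)+
  have "?Q \<noteq> {}" using ex_C1_0_nonzero[OF assms] by blast
  moreover have "bdd_below ?Q" using nonneg by (intro bdd_belowI[of _ 0]) auto
  ultimately have "c \<le> cheeger \<Omega> \<longleftrightarrow> (\<forall>\<phi>\<in>C1_0 \<Omega>. (\<exists>x. \<phi> x \<noteq> 0) \<longrightarrow> c \<le> ?P \<phi> / ?J \<phi>)"
    unfolding cheeger_def by (subst le_cInf_iff) auto
  moreover have "((\<exists>x. \<phi> x \<noteq> 0) \<longrightarrow> c \<le> ?P \<phi> / ?J \<phi>) \<longleftrightarrow> c * ?J \<phi> \<le> ?P \<phi>" if "\<phi> \<in> C1_0 \<Omega>" for \<phi>
  proof (cases "\<exists>x. \<phi> x \<noteq> 0")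
    case True
    have W: "\<phi> \<in> W1inf0 \<Omega>" using that C1_0_subset_W1inf0 by blast
    obtain x where x: "\<phi> x \<noteq> 0" using True by blast
    hence "x \<in> \<Omega>" using W by (auto simp: W1inf0_def)
    hence "?J \<phi> > 0" using zero_if_set_integral_abs_le_zero[OF W _ \<open>x \<in> \<Omega>\<close>] x by force
    thus ?thesis using True by (simp add: pos_le_divide_eq)
  next
    case False
    hence "?J \<phi> = 0" by (simp add: set_lebesgue_integral_def)
    thus ?thesis using False nonneg(2) by simp
  qed
  ultimately show ?thesis by blast
qed

theorem cheeger_inequality_W1inf0:
  assumes "\<Omega> \<noteq> {}" and u: "u \<in> W1inf0 \<Omega>"
  shows "cheeger \<Omega> * (LINT x:\<Omega>|lebesgue. \<bar>u x\<bar>) \<le> (LINT x:\<Omega>|lebesgue. norm (grad u x))"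
proof (rule tendsto_upperbound)
  let ?h = "cheeger \<Omega>" and ?m = "measure lebesgue \<Omega>" and ?J = "LINT x:\<Omega>|lebesgue. \<bar>u x\<bar>"
  show "((\<lambda>e. ?h * (?J - ?m * e)) \<longlongrightarrow> ?h * ?J) (at_right 0)"
    by (auto intro!: tendsto_eq_intros)
  have "?h * (?J - ?m * e) \<le> (LINT x:\<Omega>|lebesgue. norm (grad u x))" if e: "e > 0" for e
  proof -
    obtain \<phi> where \<phi>: "\<phi> \<in> C1_0 \<Omega>" "\<And>x. \<bar>\<phi> x - u x\<bar> \<le> e"
      "(LINT x:\<Omega>|lebesgue. norm (grad \<phi> x)) \<le> (LINT x:\<Omega>|lebesgue. norm (grad u x))"
      using C1_0_approximation[OF u e] by blast
    have \<phi>W: "\<phi> \<in> W1inf0 \<Omega>" using \<phi>(1) C1_0_subset_W1inf0 by blast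
    have const: "set_integrable lebesgue \<Omega> (\<lambda>_. e)"
      by (rule set_integrable_if_AE_bounded[of _ "\<bar>e\<bar>"]) auto
    have "?J - ?m * e = (LINT x:\<Omega>|lebesgue. \<bar>u x\<bar> - e)"
      unfolding set_integral_diff(2)[OF set_integrable_abs_W1inf0[OF u] const]
      using emeasure_lebesgue_finite by (subst set_integral_const) auto
    also have "\<dots> \<le> (LINT x:\<Omega>|lebesgue. \<bar>\<phi> x\<bar>)"
    proof (rule set_integral_mono)
      show "\<bar>u x\<bar> - e \<le> \<bar>\<phi> x\<bar>" for x using \<phi>(2)[of x] by linarith
    qed (intro set_integral_diff(1) set_integrable_abs_W1inf0 u \<phi>W const)+
    finally have "?J - ?m * e \<le> (LINT x:\<Omega>|lebesgue. \<bar>\<phi> x\<bar>)" .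
    moreover have "?h \<ge> 0"
      unfolding le_cheeger_iff[OF assms(1)] by (auto intro: set_integral_nonneg_real)
    ultimately have "?h * (?J - ?m * e) \<le> ?h * (LINT x:\<Omega>|lebesgue. \<bar>\<phi> x\<bar>)"
      by (rule mult_left_mono)
    also have "\<dots> \<le> (LINT x:\<Omega>|lebesgue. norm (grad \<phi> x))"
      using le_cheeger_iff[OF assms(1), of ?h] \<phi>(1) by blast
    finally show ?thesis using \<phi>(3) by (rule order_trans)
  qed
  thus "\<forall>\<^sub>F e in at_right 0. ?h * (?J - ?m * e) \<le> (LINT x:\<Omega>|lebesgue. norm (grad u x))"
    by (rule eventually_mono[OF eventually_at_right_less])
qed simp

end

section \<open>Minimizers\<close>

lemma tangent_less_if_strictly_convex:
  fixes f f' f'' :: "real \<Rightarrow> real"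
  assumes f: "\<And>s. s \<in> {a..} \<Longrightarrow> (f has_real_derivative f' s) (at s within {a..})"
    and f': "continuous_on {a..} f'" "\<And>s. s > a \<Longrightarrow> (f' has_real_derivative f'' s) (at s)"
    and f'': "\<And>s. s > a \<Longrightarrow> f'' s > 0" and "a < b"
  shows "f a + f' a * (b - a) < f b"
proof -
  have "\<exists>x\<in>{a<..<b}. f b - f a = f' x * (b - a)"
  proof (rule mvt_simple[OF \<open>a < b\<close>])
    fix s assume "a \<le> s" "s \<le> b"
    hence "(f has_real_derivative f' s) (at s within {a..b})"
      by (intro DERIV_subset[OF f]) auto
    thus "(f has_derivative (*) (f' s)) (at s within {a..b})"
      by (simp add: has_field_derivative_def)
  qed
  then obtain x where x: "a < x" "f b - f a = f' x * (b - a)" by auto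
  have "f' a < f' x"
    using f'(2) f''
    by (intro DERIV_pos_imp_increasing_open[OF x(1)] continuous_on_subset[OF f'(1)]) auto
  hence "f' a * (b - a) < f' x * (b - a)" using \<open>a < b\<close> by simp
  thus ?thesis using x(2) by simp
qed

lemma le_linear_near_zero_if_deriv_less:
  fixes f :: "real \<Rightarrow> real"
  assumes "(f has_real_derivative D) (at 0 within {0..})" "f 0 = 0" "c > D"
  obtains r where "r > 0" "\<And>s. 0 \<le> s \<Longrightarrow> s \<le> r \<Longrightarrow> f s \<le> c * s"
proof -
  have "((\<lambda>y. f y / y) \<longlongrightarrow> D) (at 0 within {0..})"
    using assms(1,2) by (simp add: has_field_derivative_iff)
  hence "\<forall>\<^sub>F y in at 0 within {0..}. f y / y < c" using assms(3) by (rule order_tendstoD)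
  then obtain d where "d > 0" and d: "\<And>y. y > 0 \<Longrightarrow> y < d \<Longrightarrow> f y / y < c"
    unfolding eventually_at by (auto simp: dist_real_def)
  have "f s \<le> c * s" if "0 \<le> s" "s \<le> d / 2" for s
    using d[of s] that \<open>d > 0\<close> assms(2) by (cases "s = 0") (auto simp: divide_less_eq)
  thus ?thesis using that[of "d / 2"] \<open>d > 0\<close> by simp
qed

locale radial_energy = bounded_open_set \<Omega> for \<Omega> :: "'a::euclidean_space set" +
  fixes f :: "real \<Rightarrow> real"
  assumes f_cont: "continuous_on {0..} f" and f_mono: "mono_on {0..} f" and f_zero: "f 0 = 0"
begin

lemma set_integrable_energy_density:
  assumes u: "u \<in> W1inf0 \<Omega>"
  shows "set_integrable lebesgue \<Omega> (\<lambda>x. f (norm (grad u x)))"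
proof -
  obtain L where lip: "L-lipschitz_on UNIV u" using W1inf0E[OF u] by blast
  have [measurable]: "grad u \<in> borel_measurable lebesgue" by (rule borel_measurable_grad[OF lip])
  have "continuous_on UNIV (\<lambda>s. f (max 0 s))"
    by (rule continuous_on_compose2[OF f_cont]) (auto intro!: continuous_intros)
  hence [measurable]: "(\<lambda>s. f (max 0 s)) \<in> borel_measurable borel"
    by (rule borel_measurable_continuous_onI)
  have "(\<lambda>x. f (max 0 (norm (grad u x)))) \<in> borel_measurable lebesgue" by measurable
  hence "(\<lambda>x. f (norm (grad u x))) \<in> borel_measurable lebesgue" by (simp add: max_absorb2)
  moreover  have "AE x in lborel. \<bar>f (norm (grad u x))\<bar> \<le> f L"
    using AE_norm_grad_le[OF lip]
  proof eventually_elim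
    case (elim x)
    hence "f 0 \<le> f (norm (grad u x))" "f (norm (grad u x)) \<le> f L"
      using lipschitz_on_nonneg[OF lip] by (auto intro!: mono_onD[OF f_mono])
    thus ?case using f_zero by simp
  qed
  hence "AE x in lebesgue. \<bar>f (norm (grad u x))\<bar> \<le> f L" by (simp add: AE_completion_iff)
  ultimately show ?thesis by (rule set_integrable_if_AE_bounded)
qed

lemma I_fun_eq:
  assumes "u \<in> W1inf0 \<Omega>"
  shows "I_fun f \<Omega> u = (LINT x:\<Omega>|lebesgue. f (norm (grad u x))) - (LINT x:\<Omega>|lebesgue. u x)"
  unfolding I_fun_def
  by (intro set_integral_diff(2) set_integrable_energy_density set_integrable_W1inf0 assms)

lemma I_fun_zero: "I_fun f \<Omega> (\<lambda>_. 0) = 0"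
proof -
  have "((\<lambda>_. 0) has_derivative (\<lambda>h. 0 \<bullet> h)) (at x)" for x :: 'a by simp
  hence "grad (\<lambda>_::'a. 0) x = 0" for x by (rule grad_eqI)
  thus ?thesis using f_zero by (simp add: I_fun_def set_lebesgue_integral_def)
qed

lemma I_fun_scaled_abs_le:
  assumes \<phi>: "\<phi> \<in> W1inf0 \<Omega>" and lip: "L-lipschitz_on UNIV \<phi>" and "t > 0" "c \<ge> 0"
    and f_le: "\<And>s. 0 \<le> s \<Longrightarrow> s \<le> t * L \<Longrightarrow> f s \<le> c * s"
  shows "(\<lambda>x. t * \<bar>\<phi> x\<bar>) \<in> W1inf0 \<Omega>"
    and "I_fun f \<Omega> (\<lambda>x. t * \<bar>\<phi> x\<bar>) \<le>
      t * (c * (LINT x:\<Omega>|lebesgue. norm (grad \<phi> x)) - (LINT x:\<Omega>|lebesgue. \<bar>\<phi> x\<bar>))"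
proof -
  let ?v = "\<lambda>x. t * \<bar>\<phi> x\<bar>"
  have dom: "\<bar>?v x - ?v y\<bar> \<le> t * \<bar>\<phi> x - \<phi> y\<bar>" for x y
    using mult_left_mono[OF abs_triangle_ineq3, of t] \<open>t > 0\<close>
    by (simp add: abs_mult flip: right_diff_distrib)
  show v: "?v \<in> W1inf0 \<Omega>"
    using \<phi> \<open>t > 0\<close> by (intro W1inf0_if_dominated[OF \<phi> _ dom]) (auto elim: W1inf0E)
  have "AE x in lebesgue. norm (grad ?v x) \<le> t * L"
    using AE_norm_grad_le[OF lipschitz_on_if_dominated[OF lip _ dom]] \<open>t > 0\<close>
    by (simp add: AE_completion_iff)
  moreover have "AE x in lebesgue. norm (grad ?v x) \<le> t * norm (grad \<phi> x)"
    using AE_norm_grad_le_if_dominated[OF \<phi> v _ dom] \<open>t > 0\<close> by simp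
  ultimately have "AE x in lebesgue. f (norm (grad ?v x)) \<le> c * t * norm (grad \<phi> x)"
  proof eventually_elim
    case (elim x)
    have "f (norm (grad ?v x)) \<le> c * norm (grad ?v x)" using elim(1) by (intro f_le) auto
    also have "\<dots> \<le> c * (t * norm (grad \<phi> x))" using elim(2) \<open>c \<ge> 0\<close> by (rule mult_left_mono)
    finally show ?case by (simp add: mult.assoc)
  qed
  hence "(LINT x:\<Omega>|lebesgue. f (norm (grad ?v x))) \<le> (LINT x:\<Omega>|lebesgue. c * t * norm (grad \<phi> x))"
    by (intro set_integral_mono_AE set_integrable_energy_density set_integrable_mult_right
        set_integrable_W1inf0(2) v \<phi>) auto
  thus "I_fun f \<Omega> ?v \<le> t * (c * (LINT x:\<Omega>|lebesgue. norm (grad \<phi> x)) - (LINT x:\<Omega>|lebesgue. \<bar>\<phi> x\<bar>))"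
    by (simp add: I_fun_eq[OF v] algebra_simps)
qed

lemma integral_abs_le_if_I_fun_nonneg:
  assumes \<phi>: "\<phi> \<in> W1inf0 \<Omega>" and D: "(f has_real_derivative D) (at 0 within {0..})" "D > 0"
    and nonneg: "\<And>v. v \<in> W1inf0 \<Omega> \<Longrightarrow> 0 \<le> I_fun f \<Omega> v"
  shows "(LINT x:\<Omega>|lebesgue. \<bar>\<phi> x\<bar>) \<le> D * (LINT x:\<Omega>|lebesgue. norm (grad \<phi> x))" (is "?J \<le> D * ?P")
proof (rule tendsto_lowerbound)
  show "((\<lambda>c. c * ?P) \<longlongrightarrow> D * ?P) (at_right D)" by (intro tendsto_intros)
  have "?J \<le> c * ?P" if c: "c > D" for c
  proof -
    obtain r where "r > 0" and r: "\<And>s. 0 \<le> s \<Longrightarrow> s \<le> r \<Longrightarrow> f s \<le> c * s"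
      using le_linear_near_zero_if_deriv_less[OF D(1) f_zero c] by blast
    obtain L where lip: "L-lipschitz_on UNIV \<phi>" using W1inf0E[OF \<phi>] by blast
    hence "L \<ge> 0" by (rule lipschitz_on_nonneg)
    define t where "t = r / (L + 1)"
    have t: "t > 0" "t * L \<le> r" using \<open>r > 0\<close> \<open>L \<ge> 0\<close> by (simp_all add: t_def field_simps)
    have "c \<ge> 0" using c D(2) by simp
    have "f s \<le> c * s" if "0 \<le> s" "s \<le> t * L" for s using r that t(2) by simp
    note I_fun_scaled_abs_le[OF \<phi> lip t(1) \<open>c \<ge> 0\<close> this]
    hence "0 \<le> t * (c * ?P - ?J)" using nonneg by (meson order_trans)
    thus ?thesis using t(1) by (simp add: zero_le_mult_iff)
  qed
  thus "\<forall>\<^sub>F c in at_right D. ?J \<le> c * ?P"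
    by (rule eventually_mono[OF eventually_at_right_less])
qed simp

lemma le_cheeger_if_I_fun_nonneg:
  assumes "\<Omega> \<noteq> {}" and D: "(f has_real_derivative D) (at 0 within {0..})" "D > 0"
    and nonneg: "\<And>v. v \<in> W1inf0 \<Omega> \<Longrightarrow> 0 \<le> I_fun f \<Omega> v"
  shows "1 / D \<le> cheeger \<Omega>"
  unfolding le_cheeger_iff[OF assms(1)]
proof
  fix \<phi> assume "\<phi> \<in> C1_0 \<Omega>"
  hence "\<phi> \<in> W1inf0 \<Omega>" using C1_0_subset_W1inf0 by blast
  from integral_abs_le_if_I_fun_nonneg[OF this D nonneg]
  show "1 / D * (LINT x:\<Omega>|lebesgue. \<bar>\<phi> x\<bar>) \<le> (LINT x:\<Omega>|lebesgue. norm (grad \<phi> x))"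
    using \<open>D > 0\<close> by (simp add: field_simps)
qed

lemma integral_norm_grad_eq_zero_if_energy_le:
  assumes u: "u \<in> W1inf0 \<Omega>" and f_gt: "\<And>s. s > 0 \<Longrightarrow> D * s < f s"
    and le: "(LINT x:\<Omega>|lebesgue. f (norm (grad u x))) \<le> D * (LINT x:\<Omega>|lebesgue. norm (grad u x))"
  shows "(LINT x:\<Omega>|lebesgue. norm (grad u x)) = 0"
proof -
  let ?F = "\<lambda>x. f (norm (grad u x))" and ?G = "\<lambda>x. D * norm (grad u x)"
  have f_ge: "D * norm g \<le> f (norm g)" for g :: 'a
    using f_gt[of "norm g"] f_zero by (cases "g = 0") auto
  have int: "set_integrable lebesgue \<Omega> ?G" "set_integrable lebesgue \<Omega> ?F"
    using set_integrable_W1inf0(2)[OF u] set_integrable_energy_density[OF u] by auto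
  have "AE x \<in> \<Omega> in lebesgue. ?F x - ?G x = 0"
  proof (rule AE_zero_if_set_integral_nonpos)
    show "set_integrable lebesgue \<Omega> (\<lambda>x. ?F x - ?G x)" using int by (intro set_integral_diff(1))
    show "(LINT x:\<Omega>|lebesgue. ?F x - ?G x) \<le> 0"
      using le set_integral_diff(2)[OF int(2,1)] by simp
  qed (simp add: f_ge)
  hence "AE x in lebesgue. indicator \<Omega> x *\<^sub>R norm (grad u x) = 0"
  proof eventually_elim
    case (elim x)
    hence "norm (grad u x) = 0" if "x \<in> \<Omega>"
      using f_gt[of "norm (grad u x)"] that by (cases "grad u x = 0") auto
    thus ?case by (simp add: indicator_def)
  qed
  thus ?thesis unfolding set_lebesgue_integral_def by (rule integral_eq_zero_AE)
qed

lemma zero_if_I_fun_nonpos: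
  assumes "\<Omega> \<noteq> {}" and u: "u \<in> W1inf0 \<Omega>" "I_fun f \<Omega> u \<le> 0"
    and f_gt: "\<And>s. s > 0 \<Longrightarrow> D * s < f s" and D: "D > 0" "1 \<le> D * cheeger \<Omega>"
  shows "\<forall>x\<in>\<Omega>. u x = 0"
proof -
  let ?J = "LINT x:\<Omega>|lebesgue. \<bar>u x\<bar>" and ?P = "LINT x:\<Omega>|lebesgue. norm (grad u x)"
  have "?J \<ge> 0" by (rule set_integral_nonneg_real) simp
  hence "?J \<le> D * (cheeger \<Omega> * ?J)" using mult_right_mono[OF D(2)] by (simp add: mult.assoc)
  also have "\<dots> \<le> D * ?P"
    using cheeger_inequality_W1inf0[OF assms(1) u(1)] D(1) by (intro mult_left_mono) auto
  finally have J_le: "?J \<le> D * ?P" .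
  have "(LINT x:\<Omega>|lebesgue. f (norm (grad u x))) \<le> (LINT x:\<Omega>|lebesgue. u x)"
    using u(2) by (simp add: I_fun_eq[OF u(1)])
  also have "\<dots> \<le> ?J"
    by (intro set_integral_mono set_integrable_W1inf0 set_integrable_abs_W1inf0 u(1)) simp
  also note J_le
  finally have "?P = 0"
    by (rule integral_norm_grad_eq_zero_if_energy_le[OF u(1), rotated]) (rule f_gt)
  hence "?J \<le> 0" using J_le by simp
  thus ?thesis using zero_if_set_integral_abs_le_zero[OF u(1)] by blast
qed

end

theorem theorem3p2:
  fixes \<Omega> :: "'a::euclidean_space set"
    and f f' :: "real \<Rightarrow> real"
    and u :: "'a \<Rightarrow> real"
  assumes dom: "domain \<Omega>" and bdd: "bounded \<Omega>"
    \<comment> \<open>(f1)\<close>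
    and f_C1: "\<forall>s\<ge>0. (f has_real_derivative f' s) (at s within {0..})"
    and f'_cont: "continuous_on {0..} f'"
    and f_convex: "convex_on {0..} f"
    and f_mono: "mono_on {0..} f"
    and f0: "f 0 = 0"
    and f_superlin: "filterlim (\<lambda>s. f s / s) at_top at_top"
    \<comment> \<open>(f3)\<close>
    and f'0: "f' 0 > 0"
    and f_C2a: "\<exists>\<alpha> f''. 0 < \<alpha> \<and> \<alpha> < 1 \<and>
                 (\<forall>s>0. (f' has_real_derivative f'' s) (at s)) \<and>
                 (\<forall>K. compact K \<and> K \<subseteq> {0<..} \<longrightarrow>
                     (\<exists>C. \<forall>s\<in>K. \<forall>t\<in>K. \<bar>f'' s - f'' t\<bar> \<le> C * \<bar>s - t\<bar> powr \<alpha>)) \<and>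
                 (\<forall>s>0. f'' s > 0)"
    \<comment> \<open>u is the solution of the minimization problem\<close>
    and u_W: "u \<in> W1inf0 \<Omega>"
    and u_min: "\<forall>v\<in>W1inf0 \<Omega>. I_fun f \<Omega> u \<le> I_fun f \<Omega> v"
  shows "(\<forall>x\<in>\<Omega>. u x = 0) \<longleftrightarrow> f' 0 * cheeger \<Omega> \<ge> 1"
proof
  have "\<Omega> \<noteq> {}" using dom by (simp add: domain_def)
  have f_deriv: "(f has_real_derivative f' s) (at s within {0..})" if "s \<in> {0..}" for s
    using f_C1 that by simp
  interpret radial_energy \<Omega> f
    using dom bdd DERIV_continuous_on[OF f_deriv] f_mono f0
    by unfold_locales (auto simp: domain_def)
  {
    assume "\<forall>x\<in>\<Omega>. u x = 0"
    hence "u = (\<lambda>_. 0)" using W1inf0E[OF u_W] by (metis ext)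
    hence "1 / f' 0 \<le> cheeger \<Omega>"
      using u_min I_fun_zero f'0 by (intro le_cheeger_if_I_fun_nonneg \<open>\<Omega> \<noteq> {}\<close> f_deriv) auto
    thus "f' 0 * cheeger \<Omega> \<ge> 1" using f'0 by (simp add: divide_le_eq mult.commute)
  next
    assume "f' 0 * cheeger \<Omega> \<ge> 1"
    moreover obtain f'' where "\<forall>s>0. (f' has_real_derivative f'' s) (at s)" "\<forall>s>0. f'' s > 0"
      using f_C2a by blast
    hence "f' 0 * s < f s" if "s > 0" for s
      using tangent_less_if_strictly_convex[of 0 f f' f'' s, OF f_deriv f'_cont] that f0 by simp
    moreover have "I_fun f \<Omega> u \<le> 0" using u_min zero_in_W1inf0 I_fun_zero by metis
    ultimately show "\<forall>x\<in>\<Omega>. u x = 0"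
      using zero_if_I_fun_nonpos[OF \<open>\<Omega> \<noteq> {}\<close> u_W _ _ f'0] by blast
  }
qed

end
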